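(* Let $R$ be a unitary ring. The following are equivalent (both with all words in parentheses omitted and with all of them included): (i) $R$ is a dual (strongly) self-CS-Baer right $R$-module. (ii) $R$ is a (strongly) lifting right $R$-module. (iii) $R$ is an (abelian) semiperfect ring.
   Context: A submodule $L$ of a module $M$ lies above a direct summand $K$ of $M$ if $K\subseteq L$ and $L/K$ is superfluous in $M/K$ (a submodule $A$ of $B$ is superfluous if $A+X=B$ implies $X=B$ for every submodule $X$ of $B$). A submodule $K$ of $M$ is fully invariant if $h(K)\subseteq K$ for every endomorphism $h$ of $M$. A right $R$-module $M$ is dual (strongly) self-CS-Baer if for every family $(f_i)_{i\in I}$ of endomorphisms of $M$, $\sum_{i\in I}\mathrm{Im}(f_i)$ lies above a (fully invariant) direct summand of $M$; $M$ is (strongly) lifting if every submodule of $M$ lies above a (fully invariant) direct summand of $M$. A ring is abelian if all its idempotents are central. *)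

theory Defs
  imports "HOL-Algebra.Module" "HOL-Algebra.QuotRing"
begin

text \<open>
  The locale \<^locale>\<open>module\<close> is restricted to commutative rings, so right modules over an arbitrary
  unitary ring are introduced here on the same record type. For a right module the term
  \<open>a \<odot>\<^bsub>M\<^esub> x\<close> stands for the product \<open>x a\<close> with the scalar on the right; hence the order of
  the factors in \<open>smult_assoc\<close>. The multiplicative fields of the record play no role.
\<close>

locale right_module = R?: ring R + M?: abelian_group M
  for R :: "('a, 'm) ring_scheme" (structure) and M :: "('a, 'b, 'n) module_scheme" (structure) +
  assumes smult_closed [simp, intro]:
      "\<lbrakk>a \<in> carrier R; x \<in> carrier M\<rbrakk> \<Longrightarrow> a \<odot>\<^bsub>M\<^esub> x \<in> carrier M"
    and smult_l_distr:
      "\<lbrakk>a \<in> carrier R; b \<in> carrier R; x \<in> carrier M\<rbrakk> \<Longrightarrow>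
        (a \<oplus>\<^bsub>R\<^esub> b) \<odot>\<^bsub>M\<^esub> x = a \<odot>\<^bsub>M\<^esub> x \<oplus>\<^bsub>M\<^esub> b \<odot>\<^bsub>M\<^esub> x"
    and smult_r_distr:
      "\<lbrakk>a \<in> carrier R; x \<in> carrier M; y \<in> carrier M\<rbrakk> \<Longrightarrow>
        a \<odot>\<^bsub>M\<^esub> (x \<oplus>\<^bsub>M\<^esub> y) = a \<odot>\<^bsub>M\<^esub> x \<oplus>\<^bsub>M\<^esub> a \<odot>\<^bsub>M\<^esub> y"
    and smult_assoc:
      "\<lbrakk>a \<in> carrier R; b \<in> carrier R; x \<in> carrier M\<rbrakk> \<Longrightarrow>
        (a \<otimes>\<^bsub>R\<^esub> b) \<odot>\<^bsub>M\<^esub> x = b \<odot>\<^bsub>M\<^esub> (a \<odot>\<^bsub>M\<^esub> x)"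
    and smult_one [simp]:
      "x \<in> carrier M \<Longrightarrow> \<one>\<^bsub>R\<^esub> \<odot>\<^bsub>M\<^esub> x = x"

definition right_regular :: "('a, 'm) ring_scheme \<Rightarrow> ('a, 'a) module"
  where "right_regular R =
    \<lparr>carrier = carrier R, mult = mult R, one = one R, zero = zero R, add = add R,
      smult = (\<lambda>a x. x \<otimes>\<^bsub>R\<^esub> a)\<rparr>"

definition quotient_module ::
    "('a, 'm) ring_scheme \<Rightarrow> ('a, 'b, 'n) module_scheme \<Rightarrow> 'b set \<Rightarrow> ('a, 'b set) module"
  where "quotient_module R M K =
    \<lparr>carrier = a_rcosets\<^bsub>M\<^esub> K, mult = undefined, one = undefined, zero = K, add = set_add M,
      smult = (\<lambda>a X. \<Union>x\<in>X. K +>\<^bsub>M\<^esub> (a \<odot>\<^bsub>M\<^esub> x))\<rparr>"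

definition endomorphisms ::
    "('a, 'm) ring_scheme \<Rightarrow> ('a, 'b, 'n) module_scheme \<Rightarrow> ('b \<Rightarrow> 'b) set"
  where "endomorphisms R M =
    {h. h \<in> carrier M \<rightarrow> carrier M \<and>
        (\<forall>x\<in>carrier M. \<forall>y\<in>carrier M. h (x \<oplus>\<^bsub>M\<^esub> y) = h x \<oplus>\<^bsub>M\<^esub> h y) \<and>
        (\<forall>a\<in>carrier R. \<forall>x\<in>carrier M. h (a \<odot>\<^bsub>M\<^esub> x) = a \<odot>\<^bsub>M\<^esub> h x)}"

definition sum_of_family ::
    "('a, 'b, 'n) module_scheme \<Rightarrow> 'i set \<Rightarrow> ('i \<Rightarrow> 'b set) \<Rightarrow> 'b set"
  where "sum_of_family M I N =
    {finsum M x F | x F. finite F \<and> F \<subseteq> I \<and> x \<in> (\<Pi> i\<in>F. N i)}"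

definition superfluous ::
    "('a, 'm) ring_scheme \<Rightarrow> ('a, 'b, 'n) module_scheme \<Rightarrow> 'b set \<Rightarrow> bool"
  where "superfluous R B A \<longleftrightarrow>
    submodule A R B \<and> (\<forall>X. submodule X R B \<and> A <+>\<^bsub>B\<^esub> X = carrier B \<longrightarrow> X = carrier B)"

definition direct_summand ::
    "('a, 'm) ring_scheme \<Rightarrow> ('a, 'b, 'n) module_scheme \<Rightarrow> 'b set \<Rightarrow> bool"
  where "direct_summand R M K \<longleftrightarrow>
    submodule K R M \<and>
    (\<exists>K'. submodule K' R M \<and> K <+>\<^bsub>M\<^esub> K' = carrier M \<and> K \<inter> K' = {\<zero>\<^bsub>M\<^esub>})"

definition fully_invariant ::
    "('a, 'm) ring_scheme \<Rightarrow> ('a, 'b, 'n) module_scheme \<Rightarrow> 'b set \<Rightarrow> bool"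
  where "fully_invariant R M K \<longleftrightarrow>
    submodule K R M \<and> (\<forall>h\<in>endomorphisms R M. h ` K \<subseteq> K)"

text \<open>The image of \<open>L\<close> under the projection onto the quotient by \<open>K\<close> is the submodule \<open>L/K\<close>.\<close>

definition lies_above ::
    "('a, 'm) ring_scheme \<Rightarrow> ('a, 'b, 'n) module_scheme \<Rightarrow> 'b set \<Rightarrow> 'b set \<Rightarrow> bool"
  where "lies_above R M L K \<longleftrightarrow>
    submodule L R M \<and> direct_summand R M K \<and> K \<subseteq> L \<and>
    superfluous R (quotient_module R M K) ((\<lambda>x. K +>\<^bsub>M\<^esub> x) ` L)"

text \<open>
  A definition cannot quantify over all index types. The index sets below are sets of functions
  on the module, which loses nothing: see \<open>dual_self_CS_Baer_family\<close> and
  \<open>dual_strongly_self_CS_Baer_family\<close> for families over arbitrary index types.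
\<close>

definition dual_self_CS_Baer ::
    "('a, 'm) ring_scheme \<Rightarrow> ('a, 'b, 'n) module_scheme \<Rightarrow> bool"
  where "dual_self_CS_Baer R M \<longleftrightarrow>
    (\<forall>(I :: ('b \<Rightarrow> 'b) set) f. f \<in> I \<rightarrow> endomorphisms R M \<longrightarrow>
      (\<exists>K. direct_summand R M K \<and>
        lies_above R M (sum_of_family M I (\<lambda>i. f i ` carrier M)) K))"

definition dual_strongly_self_CS_Baer ::
    "('a, 'm) ring_scheme \<Rightarrow> ('a, 'b, 'n) module_scheme \<Rightarrow> bool"
  where "dual_strongly_self_CS_Baer R M \<longleftrightarrow>
    (\<forall>(I :: ('b \<Rightarrow> 'b) set) f. f \<in> I \<rightarrow> endomorphisms R M \<longrightarrow>
      (\<exists>K. direct_summand R M K \<and> fully_invariant R M K \<and>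
        lies_above R M (sum_of_family M I (\<lambda>i. f i ` carrier M)) K))"

definition lifting ::
    "('a, 'm) ring_scheme \<Rightarrow> ('a, 'b, 'n) module_scheme \<Rightarrow> bool"
  where "lifting R M \<longleftrightarrow>
    (\<forall>L. submodule L R M \<longrightarrow> (\<exists>K. direct_summand R M K \<and> lies_above R M L K))"

definition strongly_lifting ::
    "('a, 'm) ring_scheme \<Rightarrow> ('a, 'b, 'n) module_scheme \<Rightarrow> bool"
  where "strongly_lifting R M \<longleftrightarrow>
    (\<forall>L. submodule L R M \<longrightarrow>
      (\<exists>K. direct_summand R M K \<and> fully_invariant R M K \<and> lies_above R M L K))"

definition maximal_submodule ::
    "('a, 'm) ring_scheme \<Rightarrow> ('a, 'b, 'n) module_scheme \<Rightarrow> 'b set \<Rightarrow> bool"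
  where "maximal_submodule R M N \<longleftrightarrow>
    submodule N R M \<and> N \<noteq> carrier M \<and>
    (\<forall>L. submodule L R M \<and> N \<subseteq> L \<longrightarrow> L = N \<or> L = carrier M)"

text \<open>
  The intersection of all maximal right ideals. Intersecting with the carrier gives the
  carrier itself for the zero ring, which has no maximal right ideals.
\<close>

definition jacobson_radical :: "('a, 'm) ring_scheme \<Rightarrow> 'a set"
  where "jacobson_radical R = carrier R \<inter> \<Inter>{N. maximal_submodule R (right_regular R) N}"

text \<open>Semisimple modules are those in which every submodule is a direct summand (Lam's definition).\<close>

definition semisimple_module ::
    "('a, 'm) ring_scheme \<Rightarrow> ('a, 'b, 'n) module_scheme \<Rightarrow> bool"
  where "semisimple_module R M \<longleftrightarrow> (\<forall>N. submodule N R M \<longrightarrow> direct_summand R M N)"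

definition semisimple_ring :: "('a, 'm) ring_scheme \<Rightarrow> bool"
  where "semisimple_ring R \<longleftrightarrow> semisimple_module R (right_regular R)"

definition idempotents :: "('a, 'm) ring_scheme \<Rightarrow> 'a set"
  where "idempotents R = {e \<in> carrier R. e \<otimes>\<^bsub>R\<^esub> e = e}"

definition idempotents_lift_modulo :: "('a, 'm) ring_scheme \<Rightarrow> 'a set \<Rightarrow> bool"
  where "idempotents_lift_modulo R J \<longleftrightarrow>
    (\<forall>X \<in> idempotents (R Quot J). \<exists>e \<in> idempotents R. J +>\<^bsub>R\<^esub> e = X)"

text \<open>
  Bass' definition: \<open>R/J(R)\<close> is semisimple and idempotents lift modulo the Jacobson radical \<open>J(R)\<close>.
\<close>

definition semiperfect_ring :: "('a, 'm) ring_scheme \<Rightarrow> bool"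
  where "semiperfect_ring R \<longleftrightarrow>
    semisimple_ring (R Quot jacobson_radical R) \<and>
    idempotents_lift_modulo R (jacobson_radical R)"

definition abelian_ring :: "('a, 'm) ring_scheme \<Rightarrow> bool"
  where "abelian_ring R \<longleftrightarrow>
    (\<forall>e \<in> idempotents R. \<forall>x \<in> carrier R. e \<otimes>\<^bsub>R\<^esub> x = x \<otimes>\<^bsub>R\<^esub> e)"

lemma (in ring) right_module_right_regular: "right_module R (right_regular R)"
proof -
  have "\<exists>y\<in>carrier R. y \<oplus>\<^bsub>R\<^esub> x = \<zero>\<^bsub>R\<^esub>" if "x \<in> carrier R" for x
    using that l_neg by blast
  then have "abelian_group (right_regular R)"
    by (intro abelian_groupI) (simp_all add: right_regular_def a_ac)
  then show ?thesis
    unfolding right_module_def right_module_axioms_def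
    by (auto simp: right_regular_def ring_axioms l_distr r_distr m_assoc)
qed

context right_module
begin

lemma right_module_quotient_module:
  assumes "submodule K R M"
  shows "right_module R (quotient_module R M K)"
proof -
  interpret K: submodule K R M by fact
  interpret K: abelian_subgroup K M
    by (intro abelian_subgroupI3 additive_subgroup.intro K.subgroup_axioms M.abelian_group_axioms)
  have smult_coset: "(\<Union>y\<in>K +>\<^bsub>M\<^esub> x. K +>\<^bsub>M\<^esub> (a \<odot>\<^bsub>M\<^esub> y)) = K +>\<^bsub>M\<^esub> (a \<odot>\<^bsub>M\<^esub> x)"
    if a: "a \<in> carrier R" and x: "x \<in> carrier M" for a x
  proof -
    have "K +>\<^bsub>M\<^esub> (a \<odot>\<^bsub>M\<^esub> y) = K +>\<^bsub>M\<^esub> (a \<odot>\<^bsub>M\<^esub> x)" if y: "y \<in> K +>\<^bsub>M\<^esub> x" for y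
    proof -
      obtain k where k: "k \<in> K" "y = k \<oplus>\<^bsub>M\<^esub> x"
        using y unfolding a_r_coset_def' by blast
      then have "a \<odot>\<^bsub>M\<^esub> y = a \<odot>\<^bsub>M\<^esub> k \<oplus>\<^bsub>M\<^esub> a \<odot>\<^bsub>M\<^esub> x"
        using smult_r_distr[OF a K.a_Hcarr[OF k(1)] x] by (simp only:)
      then have "a \<odot>\<^bsub>M\<^esub> y \<in> K +>\<^bsub>M\<^esub> (a \<odot>\<^bsub>M\<^esub> x)"
        using K.smult_closed[OF a k(1)] unfolding a_r_coset_def' UN_iff singleton_iff by (rule bexI)
      then have "K +>\<^bsub>M\<^esub> (a \<odot>\<^bsub>M\<^esub> x) = K +>\<^bsub>M\<^esub> (a \<odot>\<^bsub>M\<^esub> y)"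
        using a x by (intro M.a_repr_independence K.subgroup_axioms smult_closed)
      then show ?thesis by (rule sym)
    qed
    then have "(\<Union>y\<in>K +>\<^bsub>M\<^esub> x. K +>\<^bsub>M\<^esub> (a \<odot>\<^bsub>M\<^esub> y)) =
        (\<Union>y\<in>K +>\<^bsub>M\<^esub> x. K +>\<^bsub>M\<^esub> (a \<odot>\<^bsub>M\<^esub> x))"
      by (rule SUP_cong[OF refl])
    moreover have "K +>\<^bsub>M\<^esub> x \<noteq> {}" using K.a_rcos_self[OF x] by (rule ex_in_conv[THEN iffD1, OF exI])
    ultimately show ?thesis by (simp only: UN_constant if_False)
  qed
  have "abelian_group (quotient_module R M K)"
  proof (rule abelian_groupI)
    fix X assume "X \<in> carrier (quotient_module R M K)"
    then obtain x where x: "x \<in> carrier M" "X = K +>\<^bsub>M\<^esub> x"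
      unfolding quotient_module_def A_RCOSETS_def' by auto
    have "(K +>\<^bsub>M\<^esub> \<ominus>\<^bsub>M\<^esub> x) <+>\<^bsub>M\<^esub> X = K"
      using x by (simp add: K.a_rcos_sum M.l_neg M.a_coset_add_zero[OF K.a_subset])
    then show "\<exists>Y\<in>carrier (quotient_module R M K). Y \<oplus>\<^bsub>quotient_module R M K\<^esub> X =
        \<zero>\<^bsub>quotient_module R M K\<^esub>"
      using x M.a_rcosetsI[OF K.a_subset] by (auto simp: quotient_module_def)
    show "\<zero>\<^bsub>quotient_module R M K\<^esub> \<oplus>\<^bsub>quotient_module R M K\<^esub> X = X"
      using x K.a_rcos_sum[OF M.zero_closed] M.a_coset_add_zero[OF K.a_subset]
      by (simp add: quotient_module_def)
  next
    show "\<zero>\<^bsub>quotient_module R M K\<^esub> \<in> carrier (quotient_module R M K)"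
      using M.a_rcosetsI[OF K.a_subset M.zero_closed] M.a_coset_add_zero[OF K.a_subset]
      by (simp add: quotient_module_def)
  qed (auto simp: quotient_module_def A_RCOSETS_def' K.a_rcos_sum M.a_ac)
  moreover have "right_module_axioms R (quotient_module R M K)"
  proof
    fix a X assume a: "a \<in> carrier R" and "X \<in> carrier (quotient_module R M K)"
    then obtain x where "x \<in> carrier M" "X = K +>\<^bsub>M\<^esub> x"
      unfolding quotient_module_def A_RCOSETS_def' by auto
    with a show "a \<odot>\<^bsub>quotient_module R M K\<^esub> X \<in> carrier (quotient_module R M K)"
      by (simp add: quotient_module_def smult_coset M.a_rcosetsI[OF K.a_subset])
  qed (auto simp: quotient_module_def A_RCOSETS_def' smult_coset K.a_rcos_sum
        smult_l_distr smult_r_distr smult_assoc simp del: UN_simps del: equalityI subsetI)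
  ultimately show ?thesis
    by (intro right_module.intro R.ring_axioms)
qed

lemma sum_of_family_insert:
  assumes N: "\<And>i. i \<in> I \<Longrightarrow> N i \<subseteq> carrier M"
    and add: "\<And>i x y. \<lbrakk>i \<in> I; x \<in> N i; y \<in> N i\<rbrakk> \<Longrightarrow> x \<oplus>\<^bsub>M\<^esub> y \<in> N i"
    and j: "j \<in> I" and y: "y \<in> N j" and s: "s \<in> sum_of_family M I N"
  shows "y \<oplus>\<^bsub>M\<^esub> s \<in> sum_of_family M I N"
proof -
  obtain x F where F: "finite F" "F \<subseteq> I" and x: "x \<in> (\<Pi> i\<in>F. N i)" and s: "s = finsum M x F"
    using s by (auto simp: sum_of_family_def)
  have yc: "y \<in> carrier M" using N j y by auto
  have xc: "x \<in> F \<rightarrow> carrier M" using N F(2) x by (auto simp: Pi_iff subset_iff)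
  show ?thesis
  proof (cases "j \<in> F")
    case False
    let ?x = "x(j := y)"
    have "finsum M ?x (insert j F) = ?x j \<oplus>\<^bsub>M\<^esub> finsum M ?x F"
      by (rule M.finsum_insert) (use False F yc xc in auto)
    also have "finsum M ?x F = finsum M x F"
      by (rule M.finsum_cong') (use False xc in auto)
    finally have "y \<oplus>\<^bsub>M\<^esub> s = finsum M ?x (insert j F)" by (simp add: s del: fun_upd_apply) (simp only: fun_upd_same)
    moreover have "?x \<in> (\<Pi> i\<in>insert j F. N i)" using x y False by auto
    ultimately show ?thesis using F j unfolding sum_of_family_def by blast
  next
    case True
    let ?G = "F - {j}" and ?x = "x(j := y \<oplus>\<^bsub>M\<^esub> x j)"
    have FG: "F = insert j ?G" using True by auto
    have xj: "x j \<in> N j" "x j \<in> carrier M" using x xc True by auto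
    have gc: "finsum M x ?G \<in> carrier M" by (rule M.finsum_closed) (use xc in auto)
    have "finsum M x (insert j ?G) = x j \<oplus>\<^bsub>M\<^esub> finsum M x ?G"
      by (rule M.finsum_insert) (use F xc xj in auto)
    with FG have 1: "s = x j \<oplus>\<^bsub>M\<^esub> finsum M x ?G" by (simp add: s)
    have "finsum M ?x (insert j ?G) = ?x j \<oplus>\<^bsub>M\<^esub> finsum M ?x ?G"
      by (rule M.finsum_insert) (use F xc yc xj in auto)
    also have "finsum M ?x ?G = finsum M x ?G"
      by (rule M.finsum_cong') (use xc in auto)
    finally have "y \<oplus>\<^bsub>M\<^esub> s = finsum M ?x F"
      using FG 1 yc xj gc by (simp only: fun_upd_same M.a_assoc)
    moreover have "?x \<in> (\<Pi> i\<in>F. N i)" using x y add[OF j y] xj by auto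
    ultimately show ?thesis using F unfolding sum_of_family_def by blast
  qed
qed

lemma sum_of_family_reindex:
  assumes f: "f \<in> I \<rightarrow> endomorphisms R M"
  shows "sum_of_family M I (\<lambda>i. f i ` carrier M) = sum_of_family M (f ` I) (\<lambda>h. h ` carrier M)"
    (is "?L = ?R")
proof
  have endo: "h ` carrier M \<subseteq> carrier M" if "h \<in> f ` I" for h
    using that f by (auto simp: endomorphisms_def)
  have add: "u \<oplus>\<^bsub>M\<^esub> v \<in> h ` carrier M"
    if "h \<in> f ` I" "u \<in> h ` carrier M" "v \<in> h ` carrier M" for h u v
  proof -
    have "h \<in> endomorphisms R M" using that(1) f by auto
    then show ?thesis using that(2,3) unfolding endomorphisms_def
      by clarsimp (metis M.add.m_closed image_eqI)
  qed
  have zero: "\<zero>\<^bsub>M\<^esub> \<in> ?R"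
    unfolding sum_of_family_def mem_Collect_eq
    by (intro exI[where x = "\<lambda>_. \<zero>\<^bsub>M\<^esub>"] exI[where x = "{}"]) simp
  show "?L \<subseteq> ?R"
  proof
    fix s assume "s \<in> ?L"
    then obtain x F where F: "finite F" "F \<subseteq> I" and x: "x \<in> (\<Pi> i\<in>F. f i ` carrier M)"
      and s: "s = finsum M x F" unfolding sum_of_family_def by blast
    have "finsum M x F \<in> ?R" using F x
    proof (induction F rule: finite_induct)
      case empty then show ?case using zero by simp
    next
      case (insert j F)
      have c: "x i \<in> carrier M" if "i \<in> insert j F" for i
        using that insert.prems endo by blast
      have "finsum M x (insert j F) = x j \<oplus>\<^bsub>M\<^esub> finsum M x F"
        by (rule M.finsum_insert) (use insert.hyps c in auto)
      moreover have "x j \<oplus>\<^bsub>M\<^esub> finsum M x F \<in> ?R"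
      proof (rule sum_of_family_insert[where j = "f j", OF endo add])
        show "f j \<in> f ` I" using insert.prems(1) by simp
        show "x j \<in> f j ` carrier M" using insert.prems(2) by simp
        show "finsum M x F \<in> ?R" using insert.IH insert.prems by simp
      qed
      ultimately show ?case by simp
    qed
    then show "s \<in> ?R" by (simp add: s)
  qed
  show "?R \<subseteq> ?L"
  proof
    fix s assume "s \<in> ?R"
    then obtain x F where F: "finite F" "F \<subseteq> f ` I" and x: "x \<in> (\<Pi> h\<in>F. h ` carrier M)"
      and s: "s = finsum M x F" unfolding sum_of_family_def by blast
    obtain G where G: "G \<subseteq> I" "finite G" "F = f ` G" "inj_on f G"
      using F finite_imageD unfolding subset_image_inj by blast
    have "x h \<in> carrier M" if "h \<in> f ` G" for h
      using that x F(2) endo[of h] G(3) by blast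
    then have xG: "x \<in> f ` G \<rightarrow> carrier M" by blast
    have "finsum M x (f ` G) = finsum M (\<lambda>i. x (f i)) G"
      by (rule M.finsum_reindex[OF xG G(4)])
    moreover have "(\<lambda>i. x (f i)) \<in> (\<Pi> i\<in>G. f i ` carrier M)" using x G by auto
    ultimately show "s \<in> ?L" unfolding sum_of_family_def using G s by blast
  qed
qed

lemma dual_self_CS_Baer_family:
  assumes "dual_self_CS_Baer R M" and f: "f \<in> I \<rightarrow> endomorphisms R M"
  shows "\<exists>K. direct_summand R M K \<and>
    lies_above R M (sum_of_family M I (\<lambda>i. f i ` carrier M)) K"
proof -
  have "id \<in> f ` I \<rightarrow> endomorphisms R M" using f by auto
  with assms(1) have "\<exists>K. direct_summand R M K \<and>
      lies_above R M (sum_of_family M (f ` I) (\<lambda>h. id h ` carrier M)) K"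
    unfolding dual_self_CS_Baer_def by blast
  then show ?thesis by (simp only: sum_of_family_reindex[OF f] id_apply)
qed

lemma dual_strongly_self_CS_Baer_family:
  assumes "dual_strongly_self_CS_Baer R M" and f: "f \<in> I \<rightarrow> endomorphisms R M"
  shows "\<exists>K. direct_summand R M K \<and> fully_invariant R M K \<and>
    lies_above R M (sum_of_family M I (\<lambda>i. f i ` carrier M)) K"
proof -
  have "id \<in> f ` I \<rightarrow> endomorphisms R M" using f by auto
  with assms(1) have "\<exists>K. direct_summand R M K \<and> fully_invariant R M K \<and>
      lies_above R M (sum_of_family M (f ` I) (\<lambda>h. id h ` carrier M)) K"
    unfolding dual_strongly_self_CS_Baer_def by blast
  then show ?thesis by (simp only: sum_of_family_reindex[OF f] id_apply)
qed

end

end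

theory Submission
  imports Defs
begin

text \<open>
  The direct summands of the regular right module
  are the right ideals \<open>e R\<close> with \<open>e\<close> idempotent, and a right ideal \<open>L\<close> lies above \<open>e R\<close> iff
  \<open>e \<in> L\<close> and \<open>(1 - e) L\<close> is contained in the Jacobson radical \<open>J\<close>, because the superfluous right
  ideals are those inside \<open>J\<close>. As every right ideal is a sum of images of left multiplications, (i)
  and (ii) agree. If the regular module is lifting and \<open>a\<close> is idempotent modulo \<open>J\<close>, then \<open>a R\<close> lies
  above some \<open>e R\<close> and \<open>e + e a (1 - e)\<close> is an idempotent congruent to \<open>a\<close>. Conversely, for a right
  ideal \<open>L\<close> of a semiperfect ring the image of \<open>L\<close> modulo \<open>J\<close> is generated by an idempotent, which
  lifts to an idempotent of \<open>R\<close> and is then conjugated into \<open>L\<close>. In the strong case, if \<open>f R\<close> lies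
  above a fully invariant \<open>e R\<close>, then \<open>f - e f\<close> is an idempotent in \<open>J\<close>, hence \<open>f R = e R\<close> is fully
  invariant; applied to \<open>f\<close> and \<open>1 - f\<close> this makes \<open>f\<close> central.
\<close>

section \<open>Submodules and projections onto quotient modules\<close>

text \<open>Closure under negation is automatic: the negative of \<open>x\<close> is the action of
  \<open>\<ominus> \<one>\<close> on \<open>x\<close>.\<close>

lemma (in right_module) submodule_iff:
  "submodule H R M \<longleftrightarrow> H \<subseteq> carrier M \<and> \<zero>\<^bsub>M\<^esub> \<in> H \<and>
    (\<forall>x\<in>H. \<forall>y\<in>H. x \<oplus>\<^bsub>M\<^esub> y \<in> H) \<and> (\<forall>a\<in>carrier R. \<forall>x\<in>H. a \<odot>\<^bsub>M\<^esub> x \<in> H)"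
proof safe
  assume "submodule H R M"
  then interpret H: submodule H R M .
  show "x \<in> carrier M" if "x \<in> H" for x using that H.subset by auto
  show "\<zero>\<^bsub>M\<^esub> \<in> H" using H.one_closed by simp
  show "x \<oplus>\<^bsub>M\<^esub> y \<in> H" if "x \<in> H" "y \<in> H" for x y using that H.m_closed by simp
  show "a \<odot>\<^bsub>M\<^esub> x \<in> H" if "a \<in> carrier R" "x \<in> H" for a x using that by simp
next
  assume H: "H \<subseteq> carrier M" "\<zero>\<^bsub>M\<^esub> \<in> H" "\<forall>x\<in>H. \<forall>y\<in>H. x \<oplus>\<^bsub>M\<^esub> y \<in> H"
    "\<forall>a\<in>carrier R. \<forall>x\<in>H. a \<odot>\<^bsub>M\<^esub> x \<in> H"
  have "\<ominus>\<^bsub>M\<^esub> x \<in> H" if x: "x \<in> H" for x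
  proof -
    have c: "x \<in> carrier M" using x H(1) by auto
    have z: "\<zero>\<^bsub>R\<^esub> \<odot>\<^bsub>M\<^esub> x = \<zero>\<^bsub>M\<^esub>"
      using smult_l_distr[of "\<zero>\<^bsub>R\<^esub>" "\<zero>\<^bsub>R\<^esub>" x] c
      by (metis R.add.one_closed R.add.r_one M.add.r_cancel_one' smult_closed)
    have "(\<ominus>\<^bsub>R\<^esub> \<one>\<^bsub>R\<^esub>) \<odot>\<^bsub>M\<^esub> x \<oplus>\<^bsub>M\<^esub> x = \<zero>\<^bsub>M\<^esub>"
      using smult_l_distr[of "\<ominus>\<^bsub>R\<^esub> \<one>\<^bsub>R\<^esub>" "\<one>\<^bsub>R\<^esub>" x] c z by (simp add: R.l_neg)
    then have "\<ominus>\<^bsub>M\<^esub> x = (\<ominus>\<^bsub>R\<^esub> \<one>\<^bsub>R\<^esub>) \<odot>\<^bsub>M\<^esub> x"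
      using c by (simp add: M.minus_equality)
    then show ?thesis using H(4) x by simp
  qed
  then show "submodule H R M"
    using H unfolding submodule_def submodule_axioms_def
    by (auto intro!: M.add.subgroupI simp: a_inv_def)
qed

text \<open>The ring may change along with the module. This covers both the projection onto a
  quotient module, with \<open>\<sigma>\<close> the identity, and the projection of a ring onto a
  quotient ring, seen as a map between their regular modules. Surjectivity of
  \<open>\<sigma>\<close> makes the image of a submodule closed under all scalars of
  \<open>S\<close>.\<close>

locale semilinear_surjection =
  M: right_module R M + N: right_module S N
  for R :: "('a, 'm) ring_scheme" and M :: "('a, 'b, 'n) module_scheme"
    and S :: "('c, 'k) ring_scheme" and N :: "('c, 'd, 'l) module_scheme" +
  fixes \<sigma> :: "'a \<Rightarrow> 'c" and p :: "'b \<Rightarrow> 'd"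
  assumes scalars: "\<sigma> ` carrier R = carrier S"
    and surj: "p ` carrier M = carrier N"
    and add: "\<lbrakk>x \<in> carrier M; y \<in> carrier M\<rbrakk> \<Longrightarrow> p (x \<oplus>\<^bsub>M\<^esub> y) = p x \<oplus>\<^bsub>N\<^esub> p y"
    and smult: "\<lbrakk>a \<in> carrier R; x \<in> carrier M\<rbrakk> \<Longrightarrow> p (a \<odot>\<^bsub>M\<^esub> x) = \<sigma> a \<odot>\<^bsub>N\<^esub> p x"
begin

lemma zero: "p \<zero>\<^bsub>M\<^esub> = \<zero>\<^bsub>N\<^esub>"
proof -
  have "p \<zero>\<^bsub>M\<^esub> \<oplus>\<^bsub>N\<^esub> p \<zero>\<^bsub>M\<^esub> = p \<zero>\<^bsub>M\<^esub>"
    using add[of "\<zero>\<^bsub>M\<^esub>" "\<zero>\<^bsub>M\<^esub>"] by simp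
  moreover have "p \<zero>\<^bsub>M\<^esub> \<in> carrier N" using surj by auto
  ultimately show ?thesis by simp
qed

lemma submodule_image:
  assumes "submodule X R M"
  shows "submodule (p ` X) S N"
proof -
  note X = assms[unfolded M.submodule_iff]
  have "p x \<oplus>\<^bsub>N\<^esub> p y \<in> p ` X" if "x \<in> X" "y \<in> X" for x y
    using that X add[of x y] by (metis image_eqI subsetD)
  moreover have "b \<odot>\<^bsub>N\<^esub> p x \<in> p ` X" if b: "b \<in> carrier S" and x: "x \<in> X" for b x
  proof -
    obtain a where "a \<in> carrier R" "b = \<sigma> a" using b scalars by auto
    then show ?thesis using x X smult[of a x] by (metis image_eqI subsetD)
  qed
  moreover have "p ` X \<subseteq> carrier N" using X surj by blast
  moreover have "\<zero>\<^bsub>N\<^esub> \<in> p ` X" using X zero by (metis image_eqI)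
  ultimately show ?thesis
    unfolding N.submodule_iff by blast
qed

lemma submodule_vimage:
  assumes "submodule Y S N"
  shows "submodule {x \<in> carrier M. p x \<in> Y} R M"
  using assms equalityD1[OF scalars] unfolding N.submodule_iff M.submodule_iff
  by (auto simp: zero add smult image_subset_iff)

lemma image_vimage:
  assumes "submodule Y S N"
  shows "p ` {x \<in> carrier M. p x \<in> Y} = Y"
  using assms surj unfolding N.submodule_iff by auto

end

lemma (in right_module) semilinear_surjection_coset:
  assumes "submodule K R M"
  shows "semilinear_surjection R M R (quotient_module R M K) id ((+>\<^bsub>M\<^esub>) K)"
proof -
  interpret K: submodule K R M by fact
  interpret K: abelian_subgroup K M
    by (intro abelian_subgroupI3 additive_subgroup.intro K.subgroup_axioms M.abelian_group_axioms)
  \<comment> \<open>The action on the quotient is a union over representatives. All its terms agree,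
    since \<open>y\<close> differs from \<open>x\<close> by an element of \<open>K\<close> and
    \<open>K\<close> is closed under scalars; \<open>x\<close> itself shows that the union is not
    empty.\<close>
  have smult_coset: "(\<Union>y\<in>K +>\<^bsub>M\<^esub> x. K +>\<^bsub>M\<^esub> (a \<odot>\<^bsub>M\<^esub> y)) = K +>\<^bsub>M\<^esub> (a \<odot>\<^bsub>M\<^esub> x)"
    if a: "a \<in> carrier R" and x: "x \<in> carrier M" for a x
  proof -
    have "K +>\<^bsub>M\<^esub> (a \<odot>\<^bsub>M\<^esub> y) = K +>\<^bsub>M\<^esub> (a \<odot>\<^bsub>M\<^esub> x)" if y: "y \<in> K +>\<^bsub>M\<^esub> x" for y
    proof -
      obtain k where k: "k \<in> K" "y = k \<oplus>\<^bsub>M\<^esub> x"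
        using y unfolding a_r_coset_def' by blast
      have ka: "a \<odot>\<^bsub>M\<^esub> k \<in> K" "k \<in> carrier M" using k a by auto
      have "K +>\<^bsub>M\<^esub> (a \<odot>\<^bsub>M\<^esub> y) = (K +>\<^bsub>M\<^esub> (a \<odot>\<^bsub>M\<^esub> k)) <+>\<^bsub>M\<^esub> (K +>\<^bsub>M\<^esub> (a \<odot>\<^bsub>M\<^esub> x))"
        using k ka a x by (simp add: smult_r_distr K.a_rcos_sum)
      also have "\<dots> = K +>\<^bsub>M\<^esub> (a \<odot>\<^bsub>M\<^esub> x)"
        using ka a x by (simp add: K.a_rcos_const K.rcosets_add_eq M.a_rcosetsI K.a_subset)
      finally show ?thesis .
    qed
    moreover have "x \<in> K +>\<^bsub>M\<^esub> x" by (rule K.a_rcos_self[OF x])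
    ultimately show ?thesis by blast
  qed
  interpret Q: right_module R "quotient_module R M K"
    by (rule right_module_quotient_module[OF assms])
  show ?thesis
    by unfold_locales
      (auto simp: quotient_module_def A_RCOSETS_def' K.a_rcos_sum smult_coset simp del: UN_simps)
qed

lemma (in right_module) set_add_submodules:
  assumes "submodule L R M" "submodule X R M"
  shows "submodule (L <+>\<^bsub>M\<^esub> X) R M"
proof -
  note L = assms(1)[unfolded submodule_iff] and X = assms(2)[unfolded submodule_iff]
  have "\<exists>l\<in>L. \<exists>x\<in>X. (l1 \<oplus>\<^bsub>M\<^esub> x1) \<oplus>\<^bsub>M\<^esub> (l2 \<oplus>\<^bsub>M\<^esub> x2) = l \<oplus>\<^bsub>M\<^esub> x"
    if "l1 \<in> L" "l2 \<in> L" "x1 \<in> X" "x2 \<in> X" for l1 l2 x1 x2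
  proof (intro bexI)
    show "(l1 \<oplus>\<^bsub>M\<^esub> x1) \<oplus>\<^bsub>M\<^esub> (l2 \<oplus>\<^bsub>M\<^esub> x2) = (l1 \<oplus>\<^bsub>M\<^esub> l2) \<oplus>\<^bsub>M\<^esub> (x1 \<oplus>\<^bsub>M\<^esub> x2)"
      using that L X by (simp add: subset_iff M.a_ac)
  qed (use that L X in auto)
  moreover have "\<exists>l'\<in>L. \<exists>x'\<in>X. a \<odot>\<^bsub>M\<^esub> (l \<oplus>\<^bsub>M\<^esub> x) = l' \<oplus>\<^bsub>M\<^esub> x'"
    if "a \<in> carrier R" "l \<in> L" "x \<in> X" for a l x
    using that L X smult_r_distr[of a l x] by (metis subsetD)
  moreover have "\<exists>l\<in>L. \<exists>x\<in>X. \<zero>\<^bsub>M\<^esub> = l \<oplus>\<^bsub>M\<^esub> x"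
    using L X by (intro bexI[of _ "\<zero>\<^bsub>M\<^esub>"]) auto
  ultimately show ?thesis
    unfolding submodule_iff set_add_def' using L X by (auto simp: subset_iff)
qed

lemma (in right_module) subset_set_add_submodules:
  assumes L: "submodule L R M" and X: "submodule X R M"
  shows "L \<subseteq> L <+>\<^bsub>M\<^esub> X" "X \<subseteq> L <+>\<^bsub>M\<^esub> X"
proof -
  note D = L[unfolded submodule_iff] X[unfolded submodule_iff]
  have "l = l \<oplus>\<^bsub>M\<^esub> \<zero>\<^bsub>M\<^esub>" if "l \<in> L" for l using that D by auto
  then show "L \<subseteq> L <+>\<^bsub>M\<^esub> X" unfolding set_add_def' using D by blast
  have "x = \<zero>\<^bsub>M\<^esub> \<oplus>\<^bsub>M\<^esub> x" if "x \<in> X" for x using that D by auto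
  then show "X \<subseteq> L <+>\<^bsub>M\<^esub> X" unfolding set_add_def' using D by blast
qed

section \<open>Superfluity in quotients and sums of endomorphism images\<close>

text \<open>Image and preimage under the projection match the submodules of the quotient with the
  submodules of \<open>M\<close> that contain \<open>K\<close>, and images preserve sums.
  Superfluity can therefore be tested inside \<open>M\<close>, without cosets.\<close>

lemma (in right_module) superfluous_quotient_iff:
  assumes K: "submodule K R M" and L: "submodule L R M" and KL: "K \<subseteq> L"
  shows "superfluous R (quotient_module R M K) ((+>\<^bsub>M\<^esub>) K ` L) \<longleftrightarrow>
    (\<forall>X. submodule X R M \<and> K \<subseteq> X \<and> L <+>\<^bsub>M\<^esub> X = carrier M \<longrightarrow> X = carrier M)"
    (is "superfluous R ?Q (?p ` L) \<longleftrightarrow> ?rhs")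
proof -
  interpret p: semilinear_surjection R M R ?Q id ?p by (rule semilinear_surjection_coset[OF K])
  interpret K: submodule K R M by fact
  interpret K: abelian_subgroup K M
    by (intro abelian_subgroupI3 additive_subgroup.intro K.subgroup_axioms M.abelian_group_axioms)
  \<comment> \<open>A submodule containing \<open>K\<close> is a union of cosets of
    \<open>K\<close>, so it is recovered from its image.\<close>
  have sat: "{x \<in> carrier M. ?p x \<in> ?p ` X} = X" if X: "submodule X R M" "K \<subseteq> X" for X
  proof -
    note X' = X(1)[unfolded submodule_iff]
    have "x \<in> X" if x: "x \<in> carrier M" "y \<in> X" "?p x = ?p y" for x y
    proof -
      have "x \<in> ?p y" using K.a_rcos_self[OF x(1)] x(3) by simp
      then obtain k where "k \<in> K" "x = k \<oplus>\<^bsub>M\<^esub> y" unfolding a_r_coset_def' by blast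
      then show ?thesis using X X' x by auto
    qed
    then show ?thesis using X' by auto
  qed
  have sum: "?p ` (A <+>\<^bsub>M\<^esub> B) = ?p ` A <+>\<^bsub>?Q\<^esub> ?p ` B"
    if "A \<subseteq> carrier M" "B \<subseteq> carrier M" for A B
    using that p.add unfolding set_add_def'
    by (auto simp: subset_iff image_iff) (metis)+
  show ?thesis
  proof
    assume sup: "superfluous R ?Q (?p ` L)"
    show ?rhs
    proof safe
      fix X x assume X: "submodule X R M" "K \<subseteq> X" "L <+>\<^bsub>M\<^esub> X = carrier M"
      have "?p ` L <+>\<^bsub>?Q\<^esub> ?p ` X = carrier ?Q"
        using sum[of L X] X L p.surj unfolding submodule_iff by simp
      then have "?p ` X = carrier ?Q"
        using sup p.submodule_image[OF X(1)] unfolding superfluous_def by blast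
      then have "{x \<in> carrier M. ?p x \<in> ?p ` X} = carrier M"
        unfolding p.surj[symmetric] by auto
      then have "X = carrier M" using sat[OF X(1,2)] by simp
      then show "x \<in> X \<Longrightarrow> x \<in> carrier M" "x \<in> carrier M \<Longrightarrow> x \<in> X" by auto
    qed
  next
    assume rhs: ?rhs
    show "superfluous R ?Q (?p ` L)"
      unfolding superfluous_def
    proof safe
      show "submodule (?p ` L) R ?Q" by (rule p.submodule_image[OF L])
    next
      fix Y y assume Y: "submodule Y R ?Q" "?p ` L <+>\<^bsub>?Q\<^esub> Y = carrier ?Q"
      define X where "X = {x \<in> carrier M. ?p x \<in> Y}"
      have X: "submodule X R M" unfolding X_def by (rule p.submodule_vimage[OF Y(1)])
      have pX: "?p ` X = Y" unfolding X_def by (rule p.image_vimage[OF Y(1)])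
      have KX: "K \<subseteq> X"
        using Y(1) K.subset p.zero unfolding X_def p.N.submodule_iff
        by (auto simp: K.a_rcos_const M.a_coset_add_zero[OF K.a_subset])
      have LX: "submodule (L <+>\<^bsub>M\<^esub> X) R M" by (rule set_add_submodules[OF L X])
      have "K \<subseteq> L <+>\<^bsub>M\<^esub> X" using KL subset_set_add_submodules(1)[OF L X] by blast
      moreover have "?p ` (L <+>\<^bsub>M\<^esub> X) = ?p ` carrier M"
        using sum[of L X] X L pX Y(2) p.surj unfolding submodule_iff by simp
      ultimately have "L <+>\<^bsub>M\<^esub> X = carrier M" using sat[OF LX] by auto
      then have "X = carrier M" using rhs X KX by blast
      then have "Y = carrier ?Q" using pX p.surj by simp
      then show "y \<in> Y \<Longrightarrow> y \<in> carrier ?Q" "y \<in> carrier ?Q \<Longrightarrow> y \<in> Y" by auto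
    qed
  qed
qed

lemma (in right_module) submodule_sum_of_endomorphism_images:
  assumes f: "f \<in> I \<rightarrow> endomorphisms R M"
  shows "submodule (sum_of_family M I (\<lambda>i. f i ` carrier M)) R M"
    (is "submodule ?S R M")
proof -
  have c: "f i ` carrier M \<subseteq> carrier M" if "i \<in> I" for i
    using that f by (auto simp: endomorphisms_def)
  have add: "u \<oplus>\<^bsub>M\<^esub> v \<in> f i ` carrier M"
    if "i \<in> I" "u \<in> f i ` carrier M" "v \<in> f i ` carrier M" for i u v
  proof -
    have "f i \<in> endomorphisms R M" using that(1) f by auto
    then show ?thesis using that(2,3) unfolding endomorphisms_def
      by clarsimp (metis M.add.m_closed image_eqI)
  qed
  have smult: "a \<odot>\<^bsub>M\<^esub> u \<in> f i ` carrier M"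
    if "i \<in> I" "a \<in> carrier R" "u \<in> f i ` carrier M" for i a u
  proof -
    have "f i \<in> endomorphisms R M" using that(1) f by auto
    then show ?thesis using that(2,3) unfolding endomorphisms_def
      by clarsimp (metis smult_closed image_eqI)
  qed
  have zero: "\<zero>\<^bsub>M\<^esub> \<in> ?S"
    unfolding sum_of_family_def mem_Collect_eq
    by (intro exI[where x = "\<lambda>_. \<zero>\<^bsub>M\<^esub>"] exI[where x = "{}"]) simp
  \<comment> \<open>One induction on the finite index set gives both closure properties: each step
    absorbs a single summand into a sum already known to lie in the family sum, by
    \<open>sum_of_family_insert\<close>.\<close>
  have sum_closed: "finsum M x F \<oplus>\<^bsub>M\<^esub> t \<in> ?S \<and> a \<odot>\<^bsub>M\<^esub> finsum M x F \<in> ?S"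
    if "finite F" "F \<subseteq> I" "x \<in> (\<Pi> i\<in>F. f i ` carrier M)" "t \<in> ?S" "t \<in> carrier M" "a \<in> carrier R" for F x t a
    using that(1-3)
  proof (induction F rule: finite_induct)
    case empty
    have "a \<odot>\<^bsub>M\<^esub> \<zero>\<^bsub>M\<^esub> = \<zero>\<^bsub>M\<^esub>"
      using smult_r_distr[of a "\<zero>\<^bsub>M\<^esub>" "\<zero>\<^bsub>M\<^esub>"] that(6) by simp
    then show ?case using that(4,5) zero by simp
  next
    case (insert j F)
    have xc: "x i \<in> carrier M" if "i \<in> insert j F" for i
      using that insert.prems c by blast
    have xj: "x j \<in> f j ` carrier M" and j: "j \<in> I" using insert.prems by auto
    have "finsum M x (insert j F) = x j \<oplus>\<^bsub>M\<^esub> finsum M x F"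
      by (rule M.finsum_insert) (use insert.hyps xc in auto)
    moreover have "finsum M x F \<in> carrier M" by (rule M.finsum_closed) (use xc in auto)
    moreover have "x j \<oplus>\<^bsub>M\<^esub> (finsum M x F \<oplus>\<^bsub>M\<^esub> t) \<in> ?S"
      by (rule sum_of_family_insert[where j = j, OF c add]) (use insert xj j in auto)
    moreover have "a \<odot>\<^bsub>M\<^esub> x j \<oplus>\<^bsub>M\<^esub> (a \<odot>\<^bsub>M\<^esub> finsum M x F) \<in> ?S"
      by (rule sum_of_family_insert[where j = j, OF c add])
        (use insert smult[OF j that(6) xj] j in auto)
    ultimately show ?case using xc[of j] that(5,6) by (simp add: M.a_assoc smult_r_distr)
  qed
  have subset: "?S \<subseteq> carrier M"
    unfolding sum_of_family_def using c by (fastforce intro!: M.finsum_closed)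
  moreover have "s \<oplus>\<^bsub>M\<^esub> t \<in> ?S" if s: "s \<in> ?S" and t: "t \<in> ?S" for s t
  proof -
    obtain x F where "finite F" "F \<subseteq> I" "x \<in> (\<Pi> i\<in>F. f i ` carrier M)" "s = finsum M x F"
      using s unfolding sum_of_family_def by blast
    then show ?thesis using sum_closed[of F x t "\<zero>\<^bsub>R\<^esub>"] t subset by auto
  qed
  moreover have "a \<odot>\<^bsub>M\<^esub> s \<in> ?S" if a: "a \<in> carrier R" and s: "s \<in> ?S" for a s
  proof -
    obtain x F where "finite F" "F \<subseteq> I" "x \<in> (\<Pi> i\<in>F. f i ` carrier M)" "s = finsum M x F"
      using s unfolding sum_of_family_def by blast
    then show ?thesis using sum_closed[of F x "\<zero>\<^bsub>M\<^esub>" a] a zero by auto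
  qed
  ultimately show ?thesis unfolding submodule_iff using zero by blast
qed

section \<open>Right ideals of a ring\<close>

lemma right_regular_simps [simp]:
  "carrier (right_regular R) = carrier R"
  "\<zero>\<^bsub>right_regular R\<^esub> = \<zero>\<^bsub>R\<^esub>"
  "x \<oplus>\<^bsub>right_regular R\<^esub> y = x \<oplus>\<^bsub>R\<^esub> y"
  "a \<odot>\<^bsub>right_regular R\<^esub> x = x \<otimes>\<^bsub>R\<^esub> a"
  by (simp_all add: right_regular_def)

lemma set_add_right_regular [simp]: "A <+>\<^bsub>right_regular R\<^esub> B = A <+>\<^bsub>R\<^esub> B"
  by (simp add: set_add_def')

abbreviation right_ideal :: "('a, 'm) ring_scheme \<Rightarrow> 'a set \<Rightarrow> bool"
  where "right_ideal R L \<equiv> submodule L R (right_regular R)"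

context ring
begin

interpretation RR: right_module R "right_regular R"
  by (rule right_module_right_regular)

\<comment> \<open>The rules of the method \<open>algebra\<close> for rings contain \<open>l_one\<close> but not \<open>r_one\<close>.\<close>
lemmas r_one_normalisation [algebra ring "zero R" "add R" "a_inv R" "a_minus R" "one R" "mult R"] =
  r_one

lemma right_ideal_iff:
  "right_ideal R L \<longleftrightarrow> L \<subseteq> carrier R \<and> \<zero> \<in> L \<and> (\<forall>x\<in>L. \<forall>y\<in>L. x \<oplus> y \<in> L) \<and>
    (\<forall>a\<in>carrier R. \<forall>x\<in>L. x \<otimes> a \<in> L)"
  using RR.submodule_iff by simp

lemma right_idealD:
  assumes "right_ideal R L"
  shows "x \<in> L \<Longrightarrow> x \<in> carrier R" "\<zero> \<in> L" "\<lbrakk>x \<in> L; y \<in> L\<rbrakk> \<Longrightarrow> x \<oplus> y \<in> L"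
    "\<lbrakk>x \<in> L; a \<in> carrier R\<rbrakk> \<Longrightarrow> x \<otimes> a \<in> L"
    "x \<in> L \<Longrightarrow> \<ominus> x \<in> L" "\<lbrakk>x \<in> L; y \<in> L\<rbrakk> \<Longrightarrow> x \<ominus> y \<in> L"
proof -
  note L = assms[unfolded right_ideal_iff]
  show "x \<in> L \<Longrightarrow> x \<in> carrier R" "\<zero> \<in> L" "\<lbrakk>x \<in> L; y \<in> L\<rbrakk> \<Longrightarrow> x \<oplus> y \<in> L"
    "\<lbrakk>x \<in> L; a \<in> carrier R\<rbrakk> \<Longrightarrow> x \<otimes> a \<in> L" using L by auto
  have minus: "\<ominus> z \<in> L" if z: "z \<in> L" for z
  proof -
    have "z \<otimes> (\<ominus> \<one>) = \<ominus> z" using L z by (auto simp: r_minus)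
    then show ?thesis using L z by (metis a_inv_closed one_closed)
  qed
  then show "x \<in> L \<Longrightarrow> \<ominus> x \<in> L" "\<lbrakk>x \<in> L; y \<in> L\<rbrakk> \<Longrightarrow> x \<ominus> y \<in> L"
    using L by (auto simp: minus_eq)
qed

lemma right_ideal_eq_carrier_iff:
  assumes "right_ideal R L"
  shows "L = carrier R \<longleftrightarrow> \<one> \<in> L"
proof
  assume one: "\<one> \<in> L"
  have "x \<in> L" if "x \<in> carrier R" for x
    using right_idealD(4)[OF assms one that] that by simp
  then show "L = carrier R" using right_idealD(1)[OF assms] by auto
qed simp

text \<open>The sum is a right ideal, so it is everything as soon as it contains
  \<open>\<one>\<close>; comaximality becomes a single equation.\<close>

lemma right_ideal_set_add_eq_carrier_iff:
  assumes "right_ideal R L" "right_ideal R X"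
  shows "L <+>\<^bsub>R\<^esub> X = carrier R \<longleftrightarrow> (\<exists>l\<in>L. \<exists>x\<in>X. l \<oplus> x = \<one>)"
proof -
  have "right_ideal R (L <+>\<^bsub>R\<^esub> X)"
    using RR.set_add_submodules[OF assms] by simp
  then show ?thesis
    by (simp add: right_ideal_eq_carrier_iff) (force simp: set_add_def')
qed

lemma right_ideal_principal:
  assumes "a \<in> carrier R"
  shows "right_ideal R ((\<otimes>) a ` carrier R)"
  unfolding right_ideal_iff
proof (intro conjI ballI)
  show "(\<otimes>) a ` carrier R \<subseteq> carrier R" using assms by auto
  show "\<zero> \<in> (\<otimes>) a ` carrier R" by (rule image_eqI[of _ _ \<zero>]) (use assms in auto)
next
  fix x y assume "x \<in> (\<otimes>) a ` carrier R" "y \<in> (\<otimes>) a ` carrier R"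
  then obtain r s where "r \<in> carrier R" "s \<in> carrier R" "x = a \<otimes> r" "y = a \<otimes> s" by auto
  then show "x \<oplus> y \<in> (\<otimes>) a ` carrier R"
    using assms by (intro image_eqI[of _ _ "r \<oplus> s"]) (auto simp: r_distr)
next
  fix b x assume "b \<in> carrier R" "x \<in> (\<otimes>) a ` carrier R"
  then show "x \<otimes> b \<in> (\<otimes>) a ` carrier R"
    using assms by (auto simp: m_assoc)
qed

text \<open>This set is \<open>e R\<close>, written as the fixed points of left multiplication by
  \<open>e\<close> so that membership is an equation.\<close>

lemma right_ideal_idempotent:
  assumes e: "e \<in> idempotents R"
  shows "right_ideal R {x \<in> carrier R. e \<otimes> x = x}"
  using e unfolding right_ideal_iff idempotents_def by (auto simp: r_distr m_assoc[symmetric])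

section \<open>Maximal right ideals and the Jacobson radical\<close>

text \<open>Zorn's lemma applies because properness is the absence of \<open>\<one>\<close>, which
  survives unions of chains.\<close>

lemma proper_right_ideal_subset_maximal:
  assumes L: "right_ideal R L" and one: "\<one> \<notin> L"
  obtains N where "maximal_submodule R (right_regular R) N" "L \<subseteq> N"
proof -
  define A where "A = {X. right_ideal R X \<and> L \<subseteq> X \<and> \<one> \<notin> X}"
  have "\<exists>N\<in>A. \<forall>X\<in>A. N \<subseteq> X \<longrightarrow> X = N"
  proof (rule subset_Zorn_nonempty)
    show "A \<noteq> {}" using assms unfolding A_def by auto
  next
    fix C assume C: "C \<noteq> {}" "subset.chain A C"
    then have CA: "C \<subseteq> A" and chain: "\<And>X Y. X \<in> C \<Longrightarrow> Y \<in> C \<Longrightarrow> X \<subseteq> Y \<or> Y \<subseteq> X"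
      unfolding subset_chain_def by auto
    have ideals: "right_ideal R X" if "X \<in> C" for X using that CA unfolding A_def by auto
    have "right_ideal R (\<Union>C)"
      unfolding right_ideal_iff
    proof (intro conjI ballI)
      show "\<Union>C \<subseteq> carrier R" using right_idealD(1)[OF ideals] by blast
      show "\<zero> \<in> \<Union>C" using right_idealD(2)[OF ideals] C(1) by blast
    next
      fix x y assume "x \<in> \<Union>C" "y \<in> \<Union>C"
      then obtain X Y where xy: "x \<in> X" "X \<in> C" "y \<in> Y" "Y \<in> C" by blast
      obtain Z where Z: "Z \<in> C" "x \<in> Z" "y \<in> Z" using chain[OF xy(2,4)] xy by blast
      show "x \<oplus> y \<in> \<Union>C" using right_idealD(3)[OF ideals[OF Z(1)] Z(2,3)] Z(1) by blast
    next
      fix a x assume a: "a \<in> carrier R" and "x \<in> \<Union>C"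
      then obtain X where X: "x \<in> X" "X \<in> C" by blast
      show "x \<otimes> a \<in> \<Union>C" using right_idealD(4)[OF ideals[OF X(2)] X(1) a] X(2) by blast
    qed
    then show "\<Union>C \<in> A" using C CA unfolding A_def by blast
  qed
  then obtain N where N: "N \<in> A" "\<And>X. X \<in> A \<Longrightarrow> N \<subseteq> X \<Longrightarrow> X = N" by blast
  have "X = N \<or> X = carrier R" if "right_ideal R X" "N \<subseteq> X" for X
    using N that unfolding A_def by (auto simp: right_ideal_eq_carrier_iff)
  then have "maximal_submodule R (right_regular R) N"
    using N(1) unfolding A_def maximal_submodule_def by auto
  then show ?thesis using that N(1) unfolding A_def by auto
qed

text \<open>If \<open>\<one> \<ominus> x \<otimes> r\<close> has no right inverse, it lies in a
  maximal right ideal; that ideal also contains \<open>x\<close>, hence \<open>\<one>\<close>.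
  Conversely, if a maximal \<open>N\<close> misses \<open>x\<close>, then \<open>N\<close> and
  \<open>x R\<close> are comaximal, and \<open>N\<close> contains some
  \<open>\<one> \<ominus> x \<otimes> r\<close>, whose right inverse puts \<open>\<one>\<close> into
  \<open>N\<close>.\<close>

lemma mem_jacobson_radical_iff:
  "x \<in> jacobson_radical R \<longleftrightarrow>
    x \<in> carrier R \<and> (\<forall>r\<in>carrier R. \<exists>s\<in>carrier R. (\<one> \<ominus> x \<otimes> r) \<otimes> s = \<one>)"
proof
  assume x: "x \<in> jacobson_radical R"
  then have xc: "x \<in> carrier R" unfolding jacobson_radical_def by auto
  have "\<exists>s\<in>carrier R. (\<one> \<ominus> x \<otimes> r) \<otimes> s = \<one>" if r: "r \<in> carrier R" for r
  proof (rule ccontr)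
    assume no: "\<not> ?thesis"
    let ?a = "\<one> \<ominus> x \<otimes> r"
    have ac: "?a \<in> carrier R" using xc r by simp
    obtain N where N: "maximal_submodule R (right_regular R) N" "(\<otimes>) ?a ` carrier R \<subseteq> N"
    proof (rule proper_right_ideal_subset_maximal)
      show "right_ideal R ((\<otimes>) ?a ` carrier R)" by (rule right_ideal_principal[OF ac])
      show "\<one> \<notin> (\<otimes>) ?a ` carrier R" using no by (auto simp: image_iff eq_commute[of \<one>])
    qed
    then have NI: "right_ideal R N" and NR: "N \<noteq> carrier R"
      unfolding maximal_submodule_def by auto
    have "x \<in> N" using x N(1) unfolding jacobson_radical_def by auto
    then have "x \<otimes> r \<in> N" using right_idealD(4)[OF NI] r by auto
    moreover have "?a \<in> N" using N(2) ac by (metis image_subset_iff one_closed r_one)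
    moreover have "?a \<oplus> x \<otimes> r = \<one>" using xc r by algebra
    ultimately have "\<one> \<in> N" using right_idealD(3)[OF NI] by metis
    then show False using NR right_ideal_eq_carrier_iff[OF NI] by simp
  qed
  then show "x \<in> carrier R \<and> (\<forall>r\<in>carrier R. \<exists>s\<in>carrier R. (\<one> \<ominus> x \<otimes> r) \<otimes> s = \<one>)"
    using xc by auto
next
  assume x: "x \<in> carrier R \<and> (\<forall>r\<in>carrier R. \<exists>s\<in>carrier R. (\<one> \<ominus> x \<otimes> r) \<otimes> s = \<one>)"
  have "x \<in> N" if N: "maximal_submodule R (right_regular R) N" for N
  proof (rule ccontr)
    assume xN: "x \<notin> N"
    have NI: "right_ideal R N" and NR: "N \<noteq> carrier R"
      using N unfolding maximal_submodule_def by auto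
    let ?P = "(\<otimes>) x ` carrier R"
    have P: "right_ideal R ?P" using right_ideal_principal x by simp
    have NP: "right_ideal R (N <+>\<^bsub>R\<^esub> ?P)" using RR.set_add_submodules[OF NI P] by simp
    have "x \<in> ?P" using x by (intro image_eqI[of _ _ \<one>]) auto
    then have "N \<subseteq> N <+>\<^bsub>R\<^esub> ?P" "x \<in> N <+>\<^bsub>R\<^esub> ?P"
      using RR.subset_set_add_submodules[OF NI P] by auto
    then have "N <+>\<^bsub>R\<^esub> ?P = carrier R"
      using N xN NP unfolding maximal_submodule_def by auto
    then obtain n r where n: "n \<in> N" "r \<in> carrier R" "n \<oplus> x \<otimes> r = \<one>"
      using right_ideal_set_add_eq_carrier_iff[OF NI P] by auto
    have nc: "n \<in> carrier R" using n(1) right_idealD(1)[OF NI] by simp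
    have "n = (n \<oplus> x \<otimes> r) \<ominus> x \<otimes> r" using nc n(2) x by algebra
    then have "n = \<one> \<ominus> x \<otimes> r" using n(3) by simp
    then have "\<one> \<in> N" using x n(1,2) right_idealD(4)[OF NI n(1)] by metis
    then show False using NR right_ideal_eq_carrier_iff[OF NI] by simp
  qed
  then show "x \<in> jacobson_radical R" using x unfolding jacobson_radical_def by auto
qed

lemma jacobson_radical_carrier: "x \<in> jacobson_radical R \<Longrightarrow> x \<in> carrier R"
  by (simp add: mem_jacobson_radical_iff)

lemma right_ideal_jacobson_radical: "right_ideal R (jacobson_radical R)"
proof -
  have "right_ideal R N" if "maximal_submodule R (right_regular R) N" for N
    using that unfolding maximal_submodule_def by simp
  note N = right_idealD[OF this]
  show ?thesis
    unfolding right_ideal_iff jacobson_radical_def by (auto intro: N)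
qed

text \<open>A right inverse \<open>s\<close> of \<open>\<one> \<ominus> x\<close> equals
  \<open>\<one> \<oplus> x \<otimes> s\<close>, which is again \<open>\<one>\<close> minus an
  element of the radical. So \<open>s\<close> has a right inverse too, and this must coincide with
  its left inverse \<open>\<one> \<ominus> x\<close>.\<close>

lemma jacobson_radical_one_minus_Units:
  assumes x: "x \<in> jacobson_radical R"
  shows "\<one> \<ominus> x \<in> Units R"
proof -
  note J = right_idealD[OF right_ideal_jacobson_radical]
  have right_inverse: "\<exists>s\<in>carrier R. (\<one> \<ominus> y) \<otimes> s = \<one>" if y: "y \<in> jacobson_radical R" for y
    using y mem_jacobson_radical_iff[of y] by (metis one_closed r_one)
  have xc: "x \<in> carrier R" by (rule jacobson_radical_carrier[OF x])
  obtain s where s: "s \<in> carrier R" "(\<one> \<ominus> x) \<otimes> s = \<one>" using right_inverse[OF x] by blast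
  have "s = (\<one> \<ominus> x) \<otimes> s \<oplus> x \<otimes> s" using xc s(1) by algebra
  then have "s = \<one> \<oplus> x \<otimes> s" using s(2) by simp
  moreover have "\<one> \<oplus> x \<otimes> s = \<one> \<ominus> (\<ominus> (x \<otimes> s))" using xc s(1) by algebra
  moreover have "\<ominus> (x \<otimes> s) \<in> jacobson_radical R" using J(4,5) x s(1) by simp
  ultimately obtain t where t: "t \<in> carrier R" "s \<otimes> t = \<one>" using right_inverse by metis
  have "\<one> \<ominus> x = (\<one> \<ominus> x) \<otimes> (s \<otimes> t)" using t xc by simp
  also have "\<dots> = ((\<one> \<ominus> x) \<otimes> s) \<otimes> t" using s(1) t(1) xc by algebra
  also have "\<dots> = t" using s t by simp
  finally have "s \<otimes> (\<one> \<ominus> x) = \<one>" using t by simp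
  then show ?thesis unfolding Units_def using s xc by auto
qed

text \<open>Only closure under left multiplication is new. It rests on the fact that right
  invertibility passes from \<open>\<one> \<ominus> b \<otimes> t\<close> to
  \<open>\<one> \<ominus> t \<otimes> b\<close>, used with \<open>b = a \<otimes> r\<close>.\<close>

lemma ideal_jacobson_radical: "ideal (jacobson_radical R) R"
proof (rule idealI)
  note J = right_idealD[OF right_ideal_jacobson_radical]
  show "ring R" by (rule ring_axioms)
  show "subgroup (jacobson_radical R) (add_monoid R)"
    using J by (intro add.subgroupI) (auto simp: a_inv_def)
  fix a t assume a: "a \<in> jacobson_radical R" and t: "t \<in> carrier R"
  then show "a \<otimes> t \<in> jacobson_radical R" by (rule J(4))
  have ac: "a \<in> carrier R" by (rule J(1)[OF a])
  have "\<exists>s\<in>carrier R. (\<one> \<ominus> (t \<otimes> a) \<otimes> r) \<otimes> s = \<one>" if r: "r \<in> carrier R" for r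
  proof -
    have "a \<otimes> r \<otimes> t \<in> jacobson_radical R" using J(4) a r t by simp
    then obtain s where s: "s \<in> carrier R" "(\<one> \<ominus> a \<otimes> r \<otimes> t) \<otimes> s = \<one>"
      using jacobson_radical_one_minus_Units unfolding Units_def by blast
    \<comment> \<open>The witness is what the geometric series suggests:
      \<open>1/(1 - tb) = 1 + t (1/(1 - bt)) b\<close>.\<close>
    have "(\<one> \<ominus> (t \<otimes> a) \<otimes> r) \<otimes> (\<one> \<oplus> t \<otimes> s \<otimes> a \<otimes> r) =
        \<one> \<ominus> t \<otimes> a \<otimes> r \<oplus> t \<otimes> ((\<one> \<ominus> a \<otimes> r \<otimes> t) \<otimes> s) \<otimes> a \<otimes> r"
      using ac t r s(1) by algebra
    also have "\<dots> = \<one>" using ac t r unfolding s(2) by algebra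
    finally show ?thesis using ac t r s(1) by blast
  qed
  then show "t \<otimes> a \<in> jacobson_radical R"
    using ac t by (simp add: mem_jacobson_radical_iff)
qed

text \<open>The unit \<open>\<one> \<ominus> e\<close> annihilates \<open>e\<close>.\<close>

lemma idempotent_mem_jacobson_radical:
  assumes "e \<in> idempotents R" "e \<in> jacobson_radical R"
  shows "e = \<zero>"
proof -
  have e: "e \<in> carrier R" "e \<otimes> e = e" using assms(1) by (auto simp: idempotents_def)
  obtain s where s: "s \<in> carrier R" "s \<otimes> (\<one> \<ominus> e) = \<one>"
    using jacobson_radical_one_minus_Units[OF assms(2)] unfolding Units_def by blast
  have "e = s \<otimes> (\<one> \<ominus> e) \<otimes> e" using s e by simp
  also have "\<dots> = s \<otimes> (e \<ominus> e \<otimes> e)" using s(1) e(1) by algebra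
  also have "\<dots> = \<zero>" using s e by (simp add: r_neg minus_eq)
  finally show ?thesis .
qed

section \<open>Idempotents, direct summands and lying above\<close>

text \<open>Split \<open>\<one> = e \<oplus> e'\<close> along the decomposition. For
  \<open>x\<close> in \<open>K\<close> the element
  \<open>e' \<otimes> x = x \<ominus> e \<otimes> x\<close> lies in both summands, hence vanishes.
  In the other direction the complement is \<open>(1 - e) R\<close>, the annihilator of left
  multiplication by \<open>e\<close>.\<close>

lemma direct_summand_iff:
  "direct_summand R (right_regular R) K \<longleftrightarrow>
    (\<exists>e\<in>idempotents R. K = {x \<in> carrier R. e \<otimes> x = x})"
proof
  assume "direct_summand R (right_regular R) K"
  then obtain K' where K: "right_ideal R K" "right_ideal R K'" "K <+>\<^bsub>R\<^esub> K' = carrier R"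
      "K \<inter> K' = {\<zero>}"
    unfolding direct_summand_def by auto
  then obtain e e' where e: "e \<in> K" "e' \<in> K'" "e \<oplus> e' = \<one>"
    using right_ideal_set_add_eq_carrier_iff by blast
  note D = right_idealD[OF K(1)] right_idealD[OF K(2)]
  have c: "e \<in> carrier R" "e' \<in> carrier R" using e D by auto
  have ex: "e \<otimes> x = x" if x: "x \<in> K" for x
  proof -
    have xc: "x \<in> carrier R" using x D by auto
    have "e' \<otimes> x = (e \<oplus> e') \<otimes> x \<ominus> e \<otimes> x" using xc c by algebra
    then have *: "e' \<otimes> x = x \<ominus> e \<otimes> x" using e(3) xc by simp
    have "e' \<otimes> x \<in> K'" using D e(2) xc by auto
    moreover have "e' \<otimes> x \<in> K" unfolding * using D e(1) xc x by auto
    ultimately have "x \<ominus> e \<otimes> x = \<zero>" using K(4) * by auto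
    moreover have "x = (x \<ominus> e \<otimes> x) \<oplus> e \<otimes> x" using xc c by algebra
    ultimately show ?thesis using xc c by simp
  qed
  have "e \<in> idempotents R" using ex[OF e(1)] c by (simp add: idempotents_def)
  moreover have "K = {x \<in> carrier R. e \<otimes> x = x}"
    using ex D(1) D(4)[OF e(1)] by force
  ultimately show "\<exists>e\<in>idempotents R. K = {x \<in> carrier R. e \<otimes> x = x}" by blast
next
  assume "\<exists>e\<in>idempotents R. K = {x \<in> carrier R. e \<otimes> x = x}"
  then obtain e where e: "e \<in> idempotents R" and K: "K = {x \<in> carrier R. e \<otimes> x = x}" by blast
  have ec: "e \<in> carrier R" "e \<otimes> e = e" using e by (auto simp: idempotents_def)
  let ?K' = "{x \<in> carrier R. e \<otimes> x = \<zero>}"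
  have 1: "right_ideal R K" unfolding K by (rule right_ideal_idempotent[OF e])
  have 2: "right_ideal R ?K'"
    using ec unfolding right_ideal_iff by (auto simp: r_distr m_assoc[symmetric])
  have "e \<in> K" using ec K by simp
  moreover have "\<one> \<ominus> e \<in> ?K'" using ec by (simp add: minus_eq r_distr r_minus r_neg)
  moreover have "e \<oplus> (\<one> \<ominus> e) = \<one>" using ec(1) by algebra
  ultimately have "K <+>\<^bsub>R\<^esub> ?K' = carrier R"
    using right_ideal_set_add_eq_carrier_iff[OF 1 2] by blast
  moreover have "K \<inter> ?K' = {\<zero>}" using K ec by auto
  ultimately show "direct_summand R (right_regular R) K"
    unfolding direct_summand_def using 1 2 by auto
qed

text \<open>Taking \<open>x = a\<close> shows that \<open>a\<close> is an idempotent generating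
  \<open>L\<close>. The condition speaks of elements only, so it can be read modulo an
  ideal.\<close>

lemma semisimple_ring_iff:
  "semisimple_ring R \<longleftrightarrow> (\<forall>L. right_ideal R L \<longrightarrow> (\<exists>a\<in>L. \<forall>x\<in>L. a \<otimes> x = x))"
proof
  assume ss: "semisimple_ring R"
  show "\<forall>L. right_ideal R L \<longrightarrow> (\<exists>a\<in>L. \<forall>x\<in>L. a \<otimes> x = x)"
  proof (intro allI impI)
    fix L assume "right_ideal R L"
    then obtain e where "e \<in> idempotents R" "L = {x \<in> carrier R. e \<otimes> x = x}"
      using ss unfolding semisimple_ring_def semisimple_module_def direct_summand_iff by blast
    then show "\<exists>a\<in>L. \<forall>x\<in>L. a \<otimes> x = x" by (intro bexI[of _ e]) (auto simp: idempotents_def)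
  qed
next
  assume *: "\<forall>L. right_ideal R L \<longrightarrow> (\<exists>a\<in>L. \<forall>x\<in>L. a \<otimes> x = x)"
  show "semisimple_ring R"
    unfolding semisimple_ring_def semisimple_module_def direct_summand_iff
  proof (intro allI impI)
    fix L assume L: "right_ideal R L"
    then obtain a where a: "a \<in> L" "\<And>x. x \<in> L \<Longrightarrow> a \<otimes> x = x" using * by blast
    then have "a \<in> idempotents R" using right_idealD(1)[OF L] by (simp add: idempotents_def)
    moreover have "L = {x \<in> carrier R. a \<otimes> x = x}"
      using a right_idealD(1)[OF L] right_idealD(4)[OF L a(1)] by force
    ultimately show "\<exists>e\<in>idempotents R. L = {x \<in> carrier R. e \<otimes> x = x}" by blast
  qed
qed

lemma lies_above_iff:
  assumes e: "e \<in> idempotents R" and L: "right_ideal R L"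
  shows "lies_above R (right_regular R) L {x \<in> carrier R. e \<otimes> x = x} \<longleftrightarrow>
    e \<in> L \<and> (\<forall>x\<in>L. x \<ominus> e \<otimes> x \<in> jacobson_radical R)"
    (is "lies_above R _ L ?K \<longleftrightarrow> _")
proof -
  have ec: "e \<in> carrier R" "e \<otimes> e = e" using e by (auto simp: idempotents_def)
  have eK: "e \<in> ?K" using ec by simp
  note LD = right_idealD[OF L]
  have K: "right_ideal R ?K" by (rule right_ideal_idempotent[OF e])
  have KL: "?K \<subseteq> L \<longleftrightarrow> e \<in> L" using eK LD(4)[of e] by force
  have "lies_above R (right_regular R) L ?K \<longleftrightarrow>
      e \<in> L \<and> superfluous R (quotient_module R (right_regular R) ?K)
        ((\<lambda>x. ?K +>\<^bsub>right_regular R\<^esub> x) ` L)"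
    unfolding lies_above_def KL using L e direct_summand_iff by blast
  also have "\<dots> \<longleftrightarrow> e \<in> L \<and>
      (\<forall>X. right_ideal R X \<and> ?K \<subseteq> X \<and> L <+>\<^bsub>R\<^esub> X = carrier R \<longrightarrow> X = carrier R)"
    using RR.superfluous_quotient_iff[OF K L] KL by auto
  also have "\<dots> \<longleftrightarrow> e \<in> L \<and> (\<forall>x\<in>L. x \<ominus> e \<otimes> x \<in> jacobson_radical R)"
  proof (intro conj_cong refl iffI ballI allI impI)
    fix x
    assume eL: "e \<in> L" and x: "x \<in> L"
      and sup: "\<forall>X. right_ideal R X \<and> ?K \<subseteq> X \<and> L <+>\<^bsub>R\<^esub> X = carrier R \<longrightarrow> X = carrier R"
    define y where "y = x \<ominus> e \<otimes> x"
    have xc: "x \<in> carrier R" using x LD by auto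
    have yc: "y \<in> carrier R" and yL: "y \<in> L"
      unfolding y_def using xc ec LD x eL by auto
    have "e \<otimes> y = e \<otimes> x \<ominus> (e \<otimes> e) \<otimes> x" unfolding y_def using xc ec(1) by algebra
    then have ey: "e \<otimes> y = \<zero>" using xc ec by (simp add: r_neg minus_eq)
    define f where "f = \<one> \<ominus> e"
    have fc: "f \<in> carrier R" and ef: "e \<oplus> f = \<one>" using ec(1) unfolding f_def by algebra+
    have f: "f \<otimes> z = z \<ominus> e \<otimes> z" if "z \<in> carrier R" for z
      using that ec(1) unfolding f_def by algebra
    have "f \<otimes> f = f \<ominus> (e \<ominus> e \<otimes> e)"
      unfolding f_def using ec(1) by algebra
    then have ff: "f \<otimes> f = f" using ec fc by (simp add: r_neg minus_eq)
    have fy: "f \<otimes> y = y" using f[OF yc] ey yc by (simp add: minus_eq)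
    have "\<exists>s\<in>carrier R. (\<one> \<ominus> y \<otimes> r) \<otimes> s = \<one>" if r: "r \<in> carrier R" for r
    proof -
      define w where "w = y \<otimes> r"
      \<comment> \<open>Here \<open>a = (1 - w) f\<close>. The right ideal \<open>eR + aR\<close>
        contains \<open>e\<close>, and adding \<open>w \<otimes> f\<close> from \<open>L\<close> to
        \<open>e \<oplus> a\<close> gives \<open>\<one>\<close>, so superfluity makes it the whole
        ring.\<close>
      define a where "a = f \<ominus> w \<otimes> f"
      have wc: "w \<in> carrier R" and ac: "a \<in> carrier R"
        unfolding w_def a_def using yc r fc by auto
      have fw: "f \<otimes> w = w" unfolding w_def using fy fc yc r by (simp add: m_assoc[symmetric])
      have "f \<otimes> a = f \<otimes> f \<ominus> (f \<otimes> w) \<otimes> f" unfolding a_def using wc fc by algebra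
      then have fa: "f \<otimes> a = a" by (simp only: ff fw a_def)
      let ?X = "?K <+>\<^bsub>R\<^esub> (\<otimes>) a ` carrier R"
      have P: "right_ideal R ((\<otimes>) a ` carrier R)" by (rule right_ideal_principal[OF ac])
      have X: "right_ideal R ?X" using RR.set_add_submodules[OF K P] by simp
      have "a \<in> (\<otimes>) a ` carrier R" using ac by (intro image_eqI[of _ _ \<one>]) auto
      then have KX: "?K \<subseteq> ?X" and "a \<in> ?X"
        using RR.subset_set_add_submodules[OF K P] by auto
      then have "e \<oplus> a \<in> ?X" using KX eK right_idealD(3)[OF X] by blast
      moreover have "w \<otimes> f \<in> L" unfolding w_def using yL r fc LD(4) by simp
      moreover have "w \<otimes> f \<oplus> (e \<oplus> a) = \<one>"
        unfolding ef[symmetric] a_def using wc fc ec(1) by algebra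
      ultimately have "L <+>\<^bsub>R\<^esub> ?X = carrier R"
        using right_ideal_set_add_eq_carrier_iff[OF L X] by blast
      then have "?X = carrier R" using sup X KX by blast
      then have "f \<in> ?X" using fc by simp
      then obtain k b where kb: "k \<in> ?K" "b \<in> carrier R" "f = k \<oplus> a \<otimes> b"
        unfolding set_add_def' by auto
      have kc: "k \<in> carrier R" "e \<otimes> k = k" using kb by auto
      have fk: "f \<otimes> k = \<zero>" using f[OF kc(1)] kc by (simp add: r_neg minus_eq)
      \<comment> \<open>Left multiplication by \<open>f\<close> kills the component \<open>k\<close>
        in \<open>e R\<close> and fixes \<open>a\<close>.\<close>
      have "f = f \<otimes> (k \<oplus> a \<otimes> b)" using kb(3) ff by simp
      also have "\<dots> = f \<otimes> k \<oplus> (f \<otimes> a) \<otimes> b" using kc(1) kb(2) ac fc by algebra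
      also have "\<dots> = a \<otimes> b" using fa fk kb(2) ac by simp
      also have "\<dots> = (\<one> \<ominus> w) \<otimes> (f \<otimes> b)" unfolding a_def using kb(2) fc wc by algebra
      finally have fb: "(\<one> \<ominus> w) \<otimes> (f \<otimes> b) = f" by simp
      \<comment> \<open>Since \<open>f \<otimes> b\<close> solves \<open>(1 - w) z = f\<close> and
        \<open>f \<otimes> w = w\<close>, the correction \<open>(f \<otimes> b) \<otimes> w\<close>
        contributes exactly the missing \<open>w\<close>.\<close>
      have "(\<one> \<ominus> w) \<otimes> (\<one> \<oplus> (f \<otimes> b) \<otimes> w) =
          (\<one> \<ominus> w) \<oplus> ((\<one> \<ominus> w) \<otimes> (f \<otimes> b)) \<otimes> w"
        using kb(2) fc wc by algebra
      also have "\<dots> = (\<one> \<ominus> w) \<oplus> w" by (simp only: fb fw)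
      also have "\<dots> = \<one>" using wc by algebra
      finally show ?thesis unfolding w_def[symmetric] using kb(2) wc fc by blast
    qed
    then have "y \<in> jacobson_radical R" using yc by (simp add: mem_jacobson_radical_iff)
    then show "x \<ominus> e \<otimes> x \<in> jacobson_radical R" by (simp add: y_def)
  next
    fix X
    assume eL: "e \<in> L" and J: "\<forall>x\<in>L. x \<ominus> e \<otimes> x \<in> jacobson_radical R"
      and "right_ideal R X \<and> ?K \<subseteq> X \<and> L <+>\<^bsub>R\<^esub> X = carrier R"
    then have X: "right_ideal R X" and eX: "e \<in> X" and LX: "L <+>\<^bsub>R\<^esub> X = carrier R" using eK by auto
    note XD = right_idealD[OF X]
    obtain l x where l: "l \<in> L" "x \<in> X" "l \<oplus> x = \<one>"
      using right_ideal_set_add_eq_carrier_iff[OF L X] LX by blast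
    have c: "l \<in> carrier R" "x \<in> carrier R" using l LD XD by auto
    have "e \<otimes> l \<oplus> x \<in> X" using XD eX l c by auto
    moreover have "e \<otimes> l \<oplus> x = (l \<oplus> x) \<ominus> (l \<ominus> e \<otimes> l)" using c ec(1) by algebra
    ultimately have "\<one> \<ominus> (l \<ominus> e \<otimes> l) \<in> X" using l(3) by simp
    moreover have "\<one> \<ominus> (l \<ominus> e \<otimes> l) \<in> Units R"
      using jacobson_radical_one_minus_Units J l(1) by blast
    ultimately have "\<one> \<in> X" using XD(4) unfolding Units_def by fastforce
    then show "X = carrier R" using right_ideal_eq_carrier_iff[OF X] by simp
  qed
  finally show ?thesis .
qed

section \<open>Endomorphisms of the regular module and elementwise lifting conditions\<close>

text \<open>Linearity gives \<open>h x = h (1 x) = (h 1) x\<close>. Values are compared on the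
  carrier only, because \<open>h\<close> is arbitrary outside it.\<close>

lemma endomorphisms_right_regular:
  "h \<in> endomorphisms R (right_regular R) \<longleftrightarrow> (\<exists>a\<in>carrier R. \<forall>x\<in>carrier R. h x = a \<otimes> x)"
proof
  assume h: "h \<in> endomorphisms R (right_regular R)"
  have "h x = h \<one> \<otimes> x" if x: "x \<in> carrier R" for x
  proof -
    have "h (\<one> \<otimes> x) = h \<one> \<otimes> x" using h x unfolding endomorphisms_def by (simp del: l_one)
    then show ?thesis using x by simp
  qed
  moreover have "h \<one> \<in> carrier R" using h unfolding endomorphisms_def by auto
  ultimately show "\<exists>a\<in>carrier R. \<forall>x\<in>carrier R. h x = a \<otimes> x" by blast
next
  assume "\<exists>a\<in>carrier R. \<forall>x\<in>carrier R. h x = a \<otimes> x"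
  then show "h \<in> endomorphisms R (right_regular R)"
    unfolding endomorphisms_def by (auto simp: r_distr m_assoc)
qed

text \<open>Endomorphisms are left multiplications, and \<open>e\<close> generates
  \<open>e R\<close>, so it suffices that each \<open>r \<otimes> e\<close> stays in
  \<open>e R\<close>.\<close>

lemma fully_invariant_iff:
  assumes e: "e \<in> idempotents R"
  shows "fully_invariant R (right_regular R) {x \<in> carrier R. e \<otimes> x = x} \<longleftrightarrow>
    (\<forall>r\<in>carrier R. e \<otimes> (r \<otimes> e) = r \<otimes> e)"
    (is "fully_invariant R _ ?K \<longleftrightarrow> ?rhs")
proof
  have ec: "e \<in> carrier R" "e \<otimes> e = e" using e by (auto simp: idempotents_def)
  show ?rhs if inv: "fully_invariant R (right_regular R) ?K"
  proof
    fix r assume r: "r \<in> carrier R"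
    then have "(\<otimes>) r \<in> endomorphisms R (right_regular R)"
      using endomorphisms_right_regular by blast
    then have "(\<otimes>) r ` ?K \<subseteq> ?K" using inv unfolding fully_invariant_def by blast
    then show "e \<otimes> (r \<otimes> e) = r \<otimes> e" using ec by (auto simp: image_subset_iff)
  qed
  assume rhs: ?rhs
  have "h x \<in> ?K" if "h \<in> endomorphisms R (right_regular R)" "x \<in> ?K" for h x
  proof -
    obtain r where r: "r \<in> carrier R" "h x = r \<otimes> x"
      using \<open>h \<in> _\<close> \<open>x \<in> ?K\<close> endomorphisms_right_regular by auto
    have x: "x \<in> carrier R" "e \<otimes> x = x" using \<open>x \<in> ?K\<close> by auto
    have "e \<otimes> (r \<otimes> (e \<otimes> x)) = (e \<otimes> (r \<otimes> e)) \<otimes> x" using x(1) r ec(1) by algebra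
    also have "\<dots> = r \<otimes> (e \<otimes> x)" using rhs r(1) x(1) ec(1) by (simp add: m_assoc)
    finally show ?thesis using r x by simp
  qed
  then show "fully_invariant R (right_regular R) ?K"
    unfolding fully_invariant_def using right_ideal_idempotent[OF e] by auto
qed

lemma ex_direct_summand_iff:
  "(\<exists>K. direct_summand R (right_regular R) K \<and> P K) \<longleftrightarrow>
    (\<exists>e\<in>idempotents R. P {x \<in> carrier R. e \<otimes> x = x})"
  unfolding direct_summand_iff by blast

lemma lifting_iff:
  "lifting R (right_regular R) \<longleftrightarrow> (\<forall>L. right_ideal R L \<longrightarrow>
    (\<exists>e\<in>idempotents R. e \<in> L \<and> (\<forall>x\<in>L. x \<ominus> e \<otimes> x \<in> jacobson_radical R)))"
  unfolding lifting_def ex_direct_summand_iff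
  by (intro arg_cong[where f = All] ext imp_cong bex_cong refl lies_above_iff)

lemma strongly_lifting_iff:
  "strongly_lifting R (right_regular R) \<longleftrightarrow> (\<forall>L. right_ideal R L \<longrightarrow>
    (\<exists>e\<in>idempotents R. (\<forall>r\<in>carrier R. e \<otimes> (r \<otimes> e) = r \<otimes> e) \<and>
      e \<in> L \<and> (\<forall>x\<in>L. x \<ominus> e \<otimes> x \<in> jacobson_radical R)))"
  unfolding strongly_lifting_def ex_direct_summand_iff
  by (intro arg_cong[where f = All] ext imp_cong bex_cong conj_cong refl fully_invariant_iff
      lies_above_iff)

text \<open>Every right ideal \<open>L\<close> is the sum of the images of the left multiplications by its elements.\<close>

lemma sum_of_endomorphism_images_iff:
  "(\<forall>I f. f \<in> I \<rightarrow> endomorphisms R (right_regular R) \<longrightarrow>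
      P (sum_of_family (right_regular R) (I :: ('a \<Rightarrow> 'a) set) (\<lambda>i. f i ` carrier (right_regular R))))
    \<longleftrightarrow> (\<forall>L. right_ideal R L \<longrightarrow> P L)"
    (is "?lhs \<longleftrightarrow> ?rhs")
proof
  show ?lhs if rhs: ?rhs
    by (intro allI impI rhs[rule_format] RR.submodule_sum_of_endomorphism_images)
  assume lhs: ?lhs
  show ?rhs
  proof (intro allI impI)
    fix L assume L: "right_ideal R L"
    note LD = right_idealD[OF L]
    \<comment> \<open>The left multiplications index themselves: the index type of the definitions
      is that of functions on the module, so the family is \<open>id\<close> on this set.\<close>
    define I where "I = (\<lambda>l. (\<otimes>) l) ` L"
    have "(\<otimes>) l \<in> endomorphisms R (right_regular R)" if "l \<in> L" for l
      using LD(1)[OF that] endomorphisms_right_regular by blast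
    moreover have ideals: "right_ideal R (id i ` carrier (right_regular R))" if "i \<in> I" for i
      using that LD(1) right_ideal_principal unfolding I_def by auto
    ultimately have id: "id \<in> I \<rightarrow> endomorphisms R (right_regular R)" unfolding I_def by auto
    let ?S = "sum_of_family (right_regular R) I (\<lambda>i. id i ` carrier (right_regular R))"
    have S: "right_ideal R ?S" by (rule RR.submodule_sum_of_endomorphism_images[OF id])
    have "finsum (right_regular R) x F \<in> L"
      if "finite F" "F \<subseteq> I" "x \<in> (\<Pi> i\<in>F. id i ` carrier (right_regular R))" for x F
      using that
    proof (induction F rule: finite_induct)
      case empty
      then show ?case using LD(2) RR.M.finsum_empty by simp
    next
      case (insert h F)
      have xL: "x i \<in> L" if i: "i \<in> insert h F" for i
      proof -
        have "x i \<in> i ` carrier R" using insert.prems(2) i by auto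
        moreover obtain l where "l \<in> L" "i = (\<otimes>) l" using insert.prems(1) i unfolding I_def by auto
        ultimately show ?thesis using LD(4) by auto
      qed
      have "finsum (right_regular R) x (insert h F) = x h \<oplus>\<^bsub>right_regular R\<^esub> finsum (right_regular R) x F"
        by (rule RR.M.finsum_insert) (use insert.hyps xL LD(1) in auto)
      moreover have "finsum (right_regular R) x F \<in> L" using insert by simp
      ultimately show ?case using LD(3) xL[of h] by simp
    qed
    then have "?S \<subseteq> L" unfolding sum_of_family_def by blast
    moreover have "L \<subseteq> ?S"
    proof
      fix l assume l: "l \<in> L"
      \<comment> \<open>As \<open>l = l \<otimes> \<one>\<close> lies in the image of its own left
        multiplication, it can be added to the zero element of the sum.\<close>
      have "l \<oplus>\<^bsub>right_regular R\<^esub> \<zero> \<in> ?S"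
      proof (rule RR.sum_of_family_insert[where j = "(\<otimes>) l"])
        show "id i ` carrier (right_regular R) \<subseteq> carrier (right_regular R)" if "i \<in> I" for i
          using right_idealD(1)[OF ideals[OF that]] by auto
        show "x \<oplus>\<^bsub>right_regular R\<^esub> y \<in> id i ` carrier (right_regular R)"
          if "i \<in> I" "x \<in> id i ` carrier (right_regular R)" "y \<in> id i ` carrier (right_regular R)"
          for i x y
          using right_idealD(3)[OF ideals[OF that(1)] that(2,3)] by simp
        show "(\<otimes>) l \<in> I" unfolding I_def using l by blast
        show "l \<in> id ((\<otimes>) l) ` carrier (right_regular R)"
          using LD(1)[OF l] by (auto intro!: image_eqI[of _ _ \<one>])
        show "\<zero> \<in> ?S" by (rule right_idealD(2)[OF S])
      qed
      then show "l \<in> ?S" using LD(1)[OF l] by simp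
    qed
    ultimately have "L = ?S" by blast
    moreover have "P ?S" using lhs id by blast
    ultimately show "P L" by simp
  qed
qed

lemma dual_self_CS_Baer_iff_lifting:
  "dual_self_CS_Baer R (right_regular R) \<longleftrightarrow> lifting R (right_regular R)"
  unfolding dual_self_CS_Baer_def lifting_def
  by (rule sum_of_endomorphism_images_iff[where P = "\<lambda>L. \<exists>K. direct_summand R (right_regular R) K \<and>
    lies_above R (right_regular R) L K"])

lemma dual_strongly_self_CS_Baer_iff_strongly_lifting:
  "dual_strongly_self_CS_Baer R (right_regular R) \<longleftrightarrow> strongly_lifting R (right_regular R)"
  unfolding dual_strongly_self_CS_Baer_def strongly_lifting_def
  by (rule sum_of_endomorphism_images_iff[where P = "\<lambda>L. \<exists>K. direct_summand R (right_regular R) K \<and>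
    fully_invariant R (right_regular R) K \<and> lies_above R (right_regular R) L K"])

end

section \<open>Semisimplicity and idempotents of a quotient ring\<close>

text \<open>Every right ideal of the quotient is the image of its preimage, and an equation between
  cosets is a congruence between representatives.\<close>

lemma (in ideal) semisimple_ring_Quot_iff:
  "semisimple_ring (R Quot I) \<longleftrightarrow>
    (\<forall>L. right_ideal R L \<longrightarrow> (\<exists>a\<in>L. \<forall>x\<in>L. x \<ominus> a \<otimes> x \<in> I))"
proof -
  have surj: "(+>) I ` carrier R = carrier (R Quot I)"
    by (auto simp: FactRing_def A_RCOSETS_def')
  interpret Q: ring "R Quot I" by (rule quotient_is_ring)
  interpret p: semilinear_surjection R "right_regular R" "R Quot I" "right_regular (R Quot I)"
      "(+>) I" "(+>) I"
    unfolding semilinear_surjection_def semilinear_surjection_axioms_def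
    using surj right_module_right_regular Q.right_module_right_regular ring_hom_add[OF rcos_ring_hom]
      ring_hom_mult[OF rcos_ring_hom] by simp
  have eq: "I +> x = I +> y \<longleftrightarrow> x \<ominus> y \<in> I" if "x \<in> carrier R" "y \<in> carrier R" for x y
    using quotient_eq_iff_same_a_r_cos[OF ideal_axioms that] by simp
  have coset: "(\<forall>x\<in>L. (I +> a) \<otimes>\<^bsub>R Quot I\<^esub> (I +> x) = I +> x) \<longleftrightarrow> (\<forall>x\<in>L. x \<ominus> a \<otimes> x \<in> I)"
    if "L \<subseteq> carrier R" "a \<in> L" for L a
  proof (rule ball_cong[OF refl])
    fix x assume "x \<in> L"
    then have c: "x \<in> carrier R" "a \<in> carrier R" using that by auto
    have "(I +> a) \<otimes>\<^bsub>R Quot I\<^esub> (I +> x) = I +> (a \<otimes> x)"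
      using c by (simp add: FactRing_def rcoset_mult_add)
    then show "(I +> a) \<otimes>\<^bsub>R Quot I\<^esub> (I +> x) = I +> x \<longleftrightarrow> x \<ominus> a \<otimes> x \<in> I"
      using c eq[of x "a \<otimes> x"] by auto
  qed
  show ?thesis
    unfolding Q.semisimple_ring_iff
  proof (intro iffI allI impI)
    fix L assume *: "\<forall>N. right_ideal (R Quot I) N \<longrightarrow> (\<exists>a\<in>N. \<forall>x\<in>N. a \<otimes>\<^bsub>R Quot I\<^esub> x = x)"
      and L: "right_ideal R L"
    have "right_ideal (R Quot I) ((+>) I ` L)" by (rule p.submodule_image[OF L])
    then obtain a where "a \<in> L" "\<forall>x\<in>L. (I +> a) \<otimes>\<^bsub>R Quot I\<^esub> (I +> x) = I +> x"
      using * by blast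
    then show "\<exists>a\<in>L. \<forall>x\<in>L. x \<ominus> a \<otimes> x \<in> I" using coset right_idealD(1)[OF L] by blast
  next
    fix N assume *: "\<forall>L. right_ideal R L \<longrightarrow> (\<exists>a\<in>L. \<forall>x\<in>L. x \<ominus> a \<otimes> x \<in> I)"
      and N: "right_ideal (R Quot I) N"
    let ?L = "{x \<in> carrier R. I +> x \<in> N}"
    have L: "right_ideal R ?L" using p.submodule_vimage[OF N] by simp
    have NL: "(+>) I ` ?L = N" using p.image_vimage[OF N] by simp
    obtain a where a: "a \<in> ?L" "\<forall>x\<in>?L. x \<ominus> a \<otimes> x \<in> I" using * L by blast
    then have "\<forall>x\<in>?L. (I +> a) \<otimes>\<^bsub>R Quot I\<^esub> (I +> x) = I +> x" using coset[of ?L a] by blast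
    then have "\<forall>x\<in>(+>) I ` ?L. (I +> a) \<otimes>\<^bsub>R Quot I\<^esub> x = x" by (simp only: ball_simps)
    moreover have "I +> a \<in> N" using a(1) by simp
    ultimately show "\<exists>a\<in>N. \<forall>x\<in>N. a \<otimes>\<^bsub>R Quot I\<^esub> x = x"
      unfolding NL by (rule bexI)
  qed
qed

lemma (in ideal) idempotents_lift_modulo_iff:
  "idempotents_lift_modulo R I \<longleftrightarrow>
    (\<forall>a\<in>carrier R. a \<otimes> a \<ominus> a \<in> I \<longrightarrow> (\<exists>e\<in>idempotents R. e \<ominus> a \<in> I))"
proof -
  have eq: "I +> x = I +> y \<longleftrightarrow> x \<ominus> y \<in> I" if "x \<in> carrier R" "y \<in> carrier R" for x y
    using quotient_eq_iff_same_a_r_cos[OF ideal_axioms that] by simp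
  have "idempotents (R Quot I) = (+>) I ` {a \<in> carrier R. a \<otimes> a \<ominus> a \<in> I}"
  proof -
    have "I +> a \<in> idempotents (R Quot I) \<longleftrightarrow> a \<otimes> a \<ominus> a \<in> I" if "a \<in> carrier R" for a
      using that eq[of "a \<otimes> a" a] a_rcosetsI[OF a_subset that]
      by (simp add: idempotents_def FactRing_def rcoset_mult_add)
    moreover have "idempotents (R Quot I) \<subseteq> (+>) I ` carrier R"
      unfolding idempotents_def by (auto simp: FactRing_def A_RCOSETS_def')
    ultimately show ?thesis by blast
  qed
  moreover have "idempotents R \<subseteq> carrier R" unfolding idempotents_def by auto
  ultimately show ?thesis
    unfolding idempotents_lift_modulo_def using eq by (auto simp: subset_iff)
qed

section \<open>Lifting, semiperfect and abelian rings\<close>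

context ring
begin

text \<open>Semisimplicity of the quotient is immediate, as the idempotent \<open>e\<close> in
  \<open>L\<close> is a left identity of \<open>L\<close> modulo the radical. The work lies in
  lifting idempotents.\<close>

lemma lifting_imp_semiperfect_ring:
  assumes lift: "lifting R (right_regular R)"
  shows "semiperfect_ring R"
proof -
  interpret J: ideal "jacobson_radical R" R by (rule ideal_jacobson_radical)
  have "\<exists>g\<in>idempotents R. g \<ominus> a \<in> jacobson_radical R"
    if a: "a \<in> carrier R" and aJ: "a \<otimes> a \<ominus> a \<in> jacobson_radical R" for a
  proof -
    obtain e where e: "e \<in> idempotents R" "e \<in> (\<otimes>) a ` carrier R"
      "\<And>x. x \<in> (\<otimes>) a ` carrier R \<Longrightarrow> x \<ominus> e \<otimes> x \<in> jacobson_radical R"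
      using lift right_ideal_principal[OF a] unfolding lifting_iff by blast
    then obtain b where b: "b \<in> carrier R" "e = a \<otimes> b" by blast
    have ec: "e \<in> carrier R" "e \<otimes> e = e" using e(1) by (auto simp: idempotents_def)
    have "a \<in> (\<otimes>) a ` carrier R" using a by (intro image_eqI[of _ _ \<one>]) auto
    then have p: "a \<ominus> e \<otimes> a \<in> jacobson_radical R" by (rule e(3))
    have "(a \<otimes> a \<ominus> a) \<otimes> b = a \<otimes> (a \<otimes> b) \<ominus> a \<otimes> b" using a b(1) by algebra
    then have q: "a \<otimes> e \<ominus> e \<in> jacobson_radical R"
      using J.I_r_closed[OF aJ b(1)] b(2) by simp
    \<comment> \<open>Modulo the radical \<open>e a = a\<close> and \<open>a e = e\<close>, so
      \<open>e + ea - eae\<close> reduces to \<open>a\<close>. With \<open>u = a (1 - e)\<close> it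
      is \<open>e + eu\<close> where \<open>u e = 0\<close>, which makes it idempotent in
      \<open>R\<close> itself.\<close>
    define g where "g = e \<oplus> e \<otimes> a \<otimes> (\<one> \<ominus> e)"
    have gc: "g \<in> carrier R" unfolding g_def using a ec by simp
    define u where "u = a \<otimes> (\<one> \<ominus> e)"
    have uc: "u \<in> carrier R" unfolding u_def using a ec by simp
    have "u \<otimes> e = a \<otimes> (e \<ominus> e \<otimes> e)" unfolding u_def using a ec(1) by algebra
    then have ue: "u \<otimes> e = \<zero>" using a ec by (simp add: r_neg minus_eq)
    have g: "g = e \<oplus> e \<otimes> u" unfolding g_def u_def using a ec(1) by algebra
    have "g \<otimes> g = e \<otimes> e \<oplus> (e \<otimes> e) \<otimes> u \<oplus> e \<otimes> (u \<otimes> e) \<oplus> e \<otimes> (u \<otimes> e) \<otimes> u"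
      unfolding g using uc ec(1) by algebra
    then have "g \<in> idempotents R"
      using gc uc ec ue by (simp add: g idempotents_def)
    \<comment> \<open>The term \<open>e \<ominus> e \<otimes> e\<close> makes this an identity for
      arbitrary \<open>a\<close> and \<open>e\<close>; idempotence then removes it.\<close>
    moreover have "g \<ominus> a = \<ominus> (e \<otimes> (a \<otimes> e \<ominus> e) \<oplus> (a \<ominus> e \<otimes> a)) \<oplus> (e \<ominus> e \<otimes> e)"
      unfolding g_def using a ec(1) by algebra
    then have "g \<ominus> a = \<ominus> (e \<otimes> (a \<otimes> e \<ominus> e) \<oplus> (a \<ominus> e \<otimes> a))"
      using a ec by (simp add: r_neg minus_eq)
    then have "g \<ominus> a \<in> jacobson_radical R"
      using p q ec(1) by (simp add: J.I_l_closed)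
    ultimately show ?thesis by blast
  qed
  moreover have "\<exists>a\<in>L. \<forall>x\<in>L. x \<ominus> a \<otimes> x \<in> jacobson_radical R" if "right_ideal R L" for L
    using lift that unfolding lifting_iff by blast
  ultimately show ?thesis
    unfolding semiperfect_ring_def J.semisimple_ring_Quot_iff J.idempotents_lift_modulo_iff
    by blast
qed

text \<open>An idempotent \<open>g\<close> congruent modulo the radical to some \<open>a\<close> in \<open>L\<close> is conjugated into \<open>L\<close> by
  the unit \<open>u = 1 - (g - a)\<close>, because \<open>u g = a g\<close>.\<close>

lemma semiperfect_ring_imp_lifting:
  assumes semiperfect: "semiperfect_ring R"
  shows "lifting R (right_regular R)"
  unfolding lifting_iff
proof (intro allI impI)
  interpret J: ideal "jacobson_radical R" R by (rule ideal_jacobson_radical)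
  fix L assume L: "right_ideal R L"
  note LD = right_idealD[OF L]
  obtain a where a: "a \<in> L" "\<And>x. x \<in> L \<Longrightarrow> x \<ominus> a \<otimes> x \<in> jacobson_radical R"
    using semiperfect L unfolding semiperfect_ring_def J.semisimple_ring_Quot_iff by blast
  have ac: "a \<in> carrier R" by (rule LD(1)[OF a(1)])
  have "a \<otimes> a \<ominus> a = \<ominus> (a \<ominus> a \<otimes> a)" using ac by algebra
  then have "a \<otimes> a \<ominus> a \<in> jacobson_radical R" using a by simp
  then obtain g where g: "g \<in> idempotents R" and gJ: "g \<ominus> a \<in> jacobson_radical R"
    using semiperfect ac unfolding semiperfect_ring_def J.idempotents_lift_modulo_iff by blast
  have gc: "g \<in> carrier R" "g \<otimes> g = g" using g by (auto simp: idempotents_def)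
  define u where "u = \<one> \<ominus> (g \<ominus> a)"
  have uU: "u \<in> Units R" unfolding u_def by (rule jacobson_radical_one_minus_Units[OF gJ])
  have uc: "u \<in> carrier R" "inv u \<in> carrier R" using uU by auto
  have "u \<otimes> g = a \<otimes> g \<oplus> (g \<ominus> g \<otimes> g)" unfolding u_def using ac gc(1) by algebra
  then have ug: "u \<otimes> g = a \<otimes> g" using ac gc by (simp add: r_neg minus_eq)
  define e where "e = u \<otimes> g \<otimes> inv u"
  have ec: "e \<in> carrier R" unfolding e_def using uc gc by simp
  have "e \<otimes> e = u \<otimes> g \<otimes> (inv u \<otimes> u) \<otimes> g \<otimes> inv u"
    unfolding e_def using uc gc(1) by (simp add: m_assoc del: Units_l_inv)
  also have "\<dots> = u \<otimes> (g \<otimes> g) \<otimes> inv u"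
    using uU uc gc(1) by (simp add: m_assoc)
  finally have "e \<in> idempotents R" using ec gc by (simp add: idempotents_def e_def)
  \<comment> \<open>By \<open>ug\<close>, \<open>e\<close> is the product
    \<open>a \<otimes> g \<otimes> inv u\<close>, which begins with an element of
    \<open>L\<close>.\<close>
  moreover have "e \<in> L" unfolding e_def ug using a(1) gc uc LD(4) by simp
  moreover have "x \<ominus> e \<otimes> x \<in> jacobson_radical R" if x: "x \<in> L" for x
  proof -
    have xc: "x \<in> carrier R" by (rule LD(1)[OF x])
    \<comment> \<open>As \<open>e \<otimes> u = u \<otimes> g\<close>, this is the commutator of
      \<open>g\<close> and \<open>u\<close>. Since \<open>u\<close> is congruent to
      \<open>\<one>\<close>, it lies in the radical, and cancelling the unit \<open>u\<close> gives
      the same for \<open>g \<ominus> e\<close>.\<close>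
    have "(g \<ominus> e) \<otimes> u = g \<otimes> u \<ominus> u \<otimes> g \<otimes> (inv u \<otimes> u)"
      unfolding e_def using uc gc(1) by algebra
    also have "\<dots> = (g \<ominus> a) \<otimes> g \<ominus> g \<otimes> (g \<ominus> a)"
      using uU uc gc(1) ac by (simp add: u_def) algebra
    also have "\<dots> \<in> jacobson_radical R"
      using gJ gc by (simp add: J.I_l_closed J.I_r_closed minus_eq)
    finally have "(g \<ominus> e) \<otimes> u \<otimes> inv u \<in> jacobson_radical R"
      using uc by (simp only: J.I_r_closed)
    then have ge: "g \<ominus> e \<in> jacobson_radical R" using uU uc gc ec by (simp add: m_assoc)
    have "x \<ominus> e \<otimes> x = (x \<ominus> a \<otimes> x) \<oplus> ((g \<ominus> e) \<otimes> x \<ominus> (g \<ominus> a) \<otimes> x)"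
      using xc ac gc(1) ec by algebra
    also have "\<dots> \<in> jacobson_radical R"
      using a(2)[OF x] ge gJ xc by (simp add: J.I_r_closed minus_eq)
    finally show ?thesis .
  qed
  ultimately show "\<exists>e\<in>idempotents R. e \<in> L \<and> (\<forall>x\<in>L. x \<ominus> e \<otimes> x \<in> jacobson_radical R)"
    by blast
qed

text \<open>Full invariance of \<open>f R\<close> says \<open>x f = f x f\<close>; the same for
  \<open>1 - f\<close> gives \<open>f x (1 - f) = 0\<close>, that is
  \<open>f x = f x f\<close>.\<close>

lemma strongly_lifting_imp_abelian_ring:
  assumes lift: "strongly_lifting R (right_regular R)"
  shows "abelian_ring R"
proof -
  have invariant: "x \<otimes> f = f \<otimes> (x \<otimes> f)" if f: "f \<in> idempotents R" and x: "x \<in> carrier R" for f x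
  proof -
    have fc: "f \<in> carrier R" "f \<otimes> f = f" using f by (auto simp: idempotents_def)
    obtain e where e: "e \<in> idempotents R" "e \<in> {y \<in> carrier R. f \<otimes> y = y}"
      "\<And>r. r \<in> carrier R \<Longrightarrow> e \<otimes> (r \<otimes> e) = r \<otimes> e"
      "\<And>y. y \<in> {y \<in> carrier R. f \<otimes> y = y} \<Longrightarrow> y \<ominus> e \<otimes> y \<in> jacobson_radical R"
      using lift right_ideal_idempotent[OF f] unfolding strongly_lifting_iff by blast
    have ec: "e \<in> carrier R" "e \<otimes> e = e" "f \<otimes> e = e" using e by (auto simp: idempotents_def)
    \<comment> \<open>From \<open>f e = e\<close> this is an idempotent; it lies in the radical
      because \<open>f R\<close> lies above \<open>e R\<close>. Hence it is zero and
      \<open>f = e f\<close>.\<close>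
    let ?d = "f \<ominus> e \<otimes> f"
    have dc: "?d \<in> carrier R" using fc ec by simp
    have "?d \<otimes> ?d = f \<otimes> f \<ominus> (f \<otimes> e) \<otimes> f \<ominus> e \<otimes> (f \<otimes> f) \<oplus> e \<otimes> (f \<otimes> e) \<otimes> f"
      using fc(1) ec(1) by algebra
    also have "\<dots> = f \<ominus> e \<otimes> f \<ominus> e \<otimes> f \<oplus> e \<otimes> f" unfolding fc(2) ec(3) ec(2) ..
    also have "\<dots> = ?d" using fc(1) ec(1) by algebra
    finally have "?d \<in> idempotents R" using dc by (simp add: idempotents_def)
    moreover have "?d \<in> jacobson_radical R" using e(4) fc by simp
    ultimately have "?d = \<zero>" by (rule idempotent_mem_jacobson_radical)
    moreover have "f = ?d \<oplus> e \<otimes> f" using fc(1) ec(1) by algebra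
    ultimately have f: "f = e \<otimes> f" using fc ec by simp
    \<comment> \<open>Invariance passes from \<open>e\<close> to \<open>f\<close>:
      \<open>x f = x e f = e x e f = f e x e f = f x e f = f x f\<close>.\<close>
    have "x \<otimes> f = (x \<otimes> e) \<otimes> f" using f fc ec x by (simp add: m_assoc)
    also have "\<dots> = (f \<otimes> e) \<otimes> (x \<otimes> e) \<otimes> f" using e(3)[OF x] ec(3) by simp
    also have "\<dots> = f \<otimes> ((e \<otimes> (x \<otimes> e)) \<otimes> f)" using fc(1) ec(1) x by algebra
    also have "\<dots> = f \<otimes> (x \<otimes> (e \<otimes> f))" unfolding e(3)[OF x] using fc(1) ec(1) x by algebra
    also have "\<dots> = f \<otimes> (x \<otimes> f)" using f by simp
    finally show ?thesis .
  qed
  have "f \<otimes> x = x \<otimes> f" if f: "f \<in> idempotents R" and x: "x \<in> carrier R" for f x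
  proof -
    have fc: "f \<in> carrier R" "f \<otimes> f = f" using f by (auto simp: idempotents_def)
    have "(\<one> \<ominus> f) \<otimes> (\<one> \<ominus> f) = (\<one> \<ominus> f) \<ominus> (f \<ominus> f \<otimes> f)" using fc(1) by algebra
    then have "\<one> \<ominus> f \<in> idempotents R"
      using fc by (simp add: idempotents_def r_neg minus_eq)
    from invariant[OF this x]
    have eq: "x \<otimes> (\<one> \<ominus> f) = (\<one> \<ominus> f) \<otimes> (x \<otimes> (\<one> \<ominus> f))" .
    have "f \<otimes> x \<ominus> f \<otimes> (x \<otimes> f) = x \<otimes> (\<one> \<ominus> f) \<ominus> (\<one> \<ominus> f) \<otimes> (x \<otimes> (\<one> \<ominus> f))"
      using fc(1) x by algebra
    also have "\<dots> = \<zero>" using eq fc x by (simp add: r_neg minus_eq)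
    finally have z: "f \<otimes> x \<ominus> f \<otimes> (x \<otimes> f) = \<zero>" .
    have "f \<otimes> x = (f \<otimes> x \<ominus> f \<otimes> (x \<otimes> f)) \<oplus> f \<otimes> (x \<otimes> f)" using fc(1) x by algebra
    also have "\<dots> = x \<otimes> f" unfolding z using invariant[OF f x] fc x by simp
    finally show ?thesis .
  qed
  then show ?thesis unfolding abelian_ring_def by blast
qed

text \<open>A central idempotent satisfies \<open>e r e = r e e = r e\<close>, so the summand
  supplied by lifting is already fully invariant.\<close>

lemma abelian_ring_lifting_imp_strongly_lifting:
  assumes ab: "abelian_ring R" and lift: "lifting R (right_regular R)"
  shows "strongly_lifting R (right_regular R)"
proof -
  have "e \<otimes> (r \<otimes> e) = r \<otimes> e" if e: "e \<in> idempotents R" and r: "r \<in> carrier R" for e r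
  proof -
    have ec: "e \<in> carrier R" "e \<otimes> e = e" using e by (auto simp: idempotents_def)
    have "r \<otimes> e \<in> carrier R" using r ec by simp
    then have "e \<otimes> (r \<otimes> e) = r \<otimes> e \<otimes> e" using ab e unfolding abelian_ring_def by blast
    then show ?thesis using r ec by (simp add: m_assoc)
  qed
  note invariant = this
  show ?thesis
    unfolding strongly_lifting_iff
  proof (intro allI impI)
    fix L assume "right_ideal R L"
    then obtain e where e: "e \<in> idempotents R"
      "e \<in> L \<and> (\<forall>x\<in>L. x \<ominus> e \<otimes> x \<in> jacobson_radical R)"
      using lift unfolding lifting_iff by blast
    show "\<exists>e\<in>idempotents R. (\<forall>r\<in>carrier R. e \<otimes> (r \<otimes> e) = r \<otimes> e) \<and>
        e \<in> L \<and> (\<forall>x\<in>L. x \<ominus> e \<otimes> x \<in> jacobson_radical R)"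
      using e invariant[OF e(1)] by (intro bexI[of _ e] conjI ballI) simp_all
  qed
qed

end

theorem proposition5p9:
  fixes R :: "('a, 'm) ring_scheme"
  assumes "ring R"
  shows "((dual_self_CS_Baer R (right_regular R) \<longleftrightarrow> lifting R (right_regular R)) \<and>
          (lifting R (right_regular R) \<longleftrightarrow> semiperfect_ring R)) \<and>
         ((dual_strongly_self_CS_Baer R (right_regular R) \<longleftrightarrow>
             strongly_lifting R (right_regular R)) \<and>
          (strongly_lifting R (right_regular R) \<longleftrightarrow> abelian_ring R \<and> semiperfect_ring R))"
proof -
  interpret ring R by fact
  have "lifting R (right_regular R) \<longleftrightarrow> semiperfect_ring R"
    using lifting_imp_semiperfect_ring semiperfect_ring_imp_lifting by blast
  moreover have "lifting R (right_regular R)" if "strongly_lifting R (right_regular R)"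
    using that unfolding strongly_lifting_def lifting_def by blast
  ultimately show ?thesis
    using dual_self_CS_Baer_iff_lifting dual_strongly_self_CS_Baer_iff_strongly_lifting
      strongly_lifting_imp_abelian_ring abelian_ring_lifting_imp_strongly_lifting by blast
qed

end
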